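(* Let $\mathbf{k}$ be a field. Recognizable series $\alpha$ over $\mathbf{k}$ in two variables (not identically zero) are classified by isomorphism classes of data $(B,g_1,g_2,\beta)$, where $B$ is a (nonzero) commutative Frobenius $\mathbf{k}$-algebra, $g_1,g_2\in B$ is a pair of generators of $B$ as a $\mathbf{k}$-algebra, and $\beta:B\to\mathbf{k}$ is a non-degenerate trace. Explicitly, the bijection sends $\alpha$ to $(A_\alpha, T_1,T_2,\alpha)$, where $A_\alpha=\mathbf{k}[T_1,T_2]/I_\alpha$ is equipped with the (nondegenerate) trace induced by $\alpha$, and its inverse sends $(B,g_1,g_2,\beta)$ to the recognizable series $\sum_{\ell,g\ge 0}\beta(g_1^{\ell}g_2^{g})\,T_1^{\ell}T_2^{g}$.
   Context: A series $\alpha=(\alpha_{\ell,g})_{\ell,g\ge 0}$ with $\alpha_{\ell,g}\in\mathbf{k}$ is encoded as the power series $Z_\alpha(T_1,T_2)=\sum_{\ell,g\ge0}\alpha_{\ell,g}T_1^\ell T_2^g$ and identified with the linear functional $\alpha:\mathbf{k}[T_1,T_2]\to\mathbf{k}$, $\alpha(T_1^\ell T_2^g)=\alpha_{\ell,g}$. It is called recognizable if $\ker(\alpha)$ contains an ideal of $\mathbf{k}[T_1,T_2]$ of finite codimension. The ideal $I_\alpha=\{z\in \mathbf{k}[T_1,T_2] : \alpha(zf)=0 \text{ for all } f\in\mathbf{k}[T_1,T_2]\}$ is the largest ideal contained in $\ker(\alpha)$. A trace $\beta$ on a finite-dimensional commutative algebra $B$ is a linear functional; it is non-degenerate if the bilinear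 form $(x,y)\mapsto\beta(xy)$ is non-degenerate; a commutative Frobenius algebra is a finite-dimensional commutative algebra admitting a non-degenerate trace. An isomorphism $(B,g_1,g_2,\beta)\cong(B',g_1',g_2',\beta')$ is a $\mathbf{k}$-algebra isomorphism $B\to B'$ taking $g_i$ to $g_i'$ and $\beta'$ to $\beta$ under pullback. *)

theory Defs
  imports "HOL-Algebra.UnivPoly" "HOL-Algebra.QuotRing" "HOL-Algebra.Subrings"
begin

text \<open>Algebras over \<open>K\<close> are HOL-Algebra's (commutative, unital) \<^locale>\<open>algebra\<close>s \<open>K B\<close>,
  with \<open>B\<close> a \<open>module\<close> record carrying the ring structure and the scalar action.\<close>

section \<open>Finite dimension, generation, quotients\<close>

definition finite_dim :: "('a, 'm) ring_scheme \<Rightarrow> ('a, 'b) module \<Rightarrow> bool" where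
  "finite_dim K V \<longleftrightarrow>
     (\<exists>S. finite S \<and> S \<subseteq> carrier V \<and>
        (\<forall>x \<in> carrier V. \<exists>c \<in> S \<rightarrow> carrier K. x = (\<Oplus>\<^bsub>V\<^esub>s\<in>S. c s \<odot>\<^bsub>V\<^esub> s)))"

definition is_subalgebra :: "('a, 'm) ring_scheme \<Rightarrow> ('a, 'b) module \<Rightarrow> 'b set \<Rightarrow> bool" where
  "is_subalgebra K B A \<longleftrightarrow>
     subring A B \<and> (\<forall>c \<in> carrier K. \<forall>x \<in> A. c \<odot>\<^bsub>B\<^esub> x \<in> A)"

definition algebra_generated :: "('a, 'm) ring_scheme \<Rightarrow> ('a, 'b) module \<Rightarrow> 'b set \<Rightarrow> 'b set" where
  "algebra_generated K B S = \<Inter>{A. is_subalgebra K B A \<and> S \<subseteq> A}"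

definition quot_algebra :: "('a, 'b) module \<Rightarrow> 'b set \<Rightarrow> ('a, 'b set) module" where
  "quot_algebra B I =
     \<lparr> carrier = carrier (B Quot I), mult = mult (B Quot I), one = one (B Quot I),
       zero = zero (B Quot I), add = add (B Quot I),
       smult = (\<lambda>c X. \<Union>x\<in>X. I +>\<^bsub>B\<^esub> (c \<odot>\<^bsub>B\<^esub> x)) \<rparr>"

section \<open>The algebra of polynomials in two variables\<close>

text \<open>The polynomial algebra in \<open>T\<^sub>1, T\<^sub>2\<close> is realised as the iterated polynomial ring
  \<open>K[T\<^sub>1][T\<^sub>2]\<close>: the outer index is the exponent of \<open>T\<^sub>2\<close>, the inner one that of \<open>T\<^sub>1\<close>.\<close>

type_synonym 'a bipoly = "nat \<Rightarrow> nat \<Rightarrow> 'a"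

definition bipoly_algebra :: "('a, 'm) ring_scheme \<Rightarrow> ('a, 'a bipoly) module" where
  "bipoly_algebra K =
     \<lparr> carrier = carrier (UP (UP K)), mult = mult (UP (UP K)), one = one (UP (UP K)),
       zero = zero (UP (UP K)), add = add (UP (UP K)),
       smult = (\<lambda>c p. monom (UP K) c 0 \<odot>\<^bsub>UP (UP K)\<^esub> p) \<rparr>"

definition T1 :: "('a, 'm) ring_scheme \<Rightarrow> 'a bipoly" where
  "T1 K = monom (UP (UP K)) (monom (UP K) \<one>\<^bsub>K\<^esub> 1) 0"

definition T2 :: "('a, 'm) ring_scheme \<Rightarrow> 'a bipoly" where
  "T2 K = monom (UP (UP K)) \<one>\<^bsub>UP K\<^esub> 1"

definition bicoeff :: "('a, 'm) ring_scheme \<Rightarrow> 'a bipoly \<Rightarrow> nat \<Rightarrow> nat \<Rightarrow> 'a" where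
  "bicoeff K p l g = coeff (UP K) (coeff (UP (UP K)) p g) l"

section \<open>Recognizable series\<close>

text \<open>A series is its coefficient family: \<open>\<alpha> l g\<close> is the coefficient of \<open>T\<^sub>1\<^sup>l T\<^sub>2\<^sup>g\<close>
  in the generating power series.\<close>

type_synonym 'a biseries = "nat \<Rightarrow> nat \<Rightarrow> 'a"

definition biseries :: "('a, 'm) ring_scheme \<Rightarrow> 'a biseries set" where
  "biseries K = {\<alpha>. \<forall>l g. \<alpha> l g \<in> carrier K}"

definition functional :: "('a, 'm) ring_scheme \<Rightarrow> 'a biseries \<Rightarrow> 'a bipoly \<Rightarrow> 'a" where
  "functional K \<alpha> p =
     (\<Oplus>\<^bsub>K\<^esub>i \<in> {(l, g). bicoeff K p l g \<noteq> \<zero>\<^bsub>K\<^esub>}.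
        case i of (l, g) \<Rightarrow> bicoeff K p l g \<otimes>\<^bsub>K\<^esub> \<alpha> l g)"

definition functional_kernel :: "('a, 'm) ring_scheme \<Rightarrow> 'a biseries \<Rightarrow> 'a bipoly set" where
  "functional_kernel K \<alpha> =
     {p \<in> carrier (bipoly_algebra K). functional K \<alpha> p = \<zero>\<^bsub>K\<^esub>}"

definition recognizable :: "('a, 'm) ring_scheme \<Rightarrow> 'a biseries \<Rightarrow> bool" where
  "recognizable K \<alpha> \<longleftrightarrow>
     \<alpha> \<in> biseries K \<and>
     (\<exists>J. ideal J (bipoly_algebra K) \<and> J \<subseteq> functional_kernel K \<alpha> \<and>
          finite_dim K (quot_algebra (bipoly_algebra K) J))"

definition nonzero_recognizable :: "('a, 'm) ring_scheme \<Rightarrow> 'a biseries set" where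
  "nonzero_recognizable K = {\<alpha>. recognizable K \<alpha> \<and> (\<exists>l g. \<alpha> l g \<noteq> \<zero>\<^bsub>K\<^esub>)}"

definition syntactic_ideal :: "('a, 'm) ring_scheme \<Rightarrow> 'a biseries \<Rightarrow> 'a bipoly set" where
  "syntactic_ideal K \<alpha> =
     {z \<in> carrier (bipoly_algebra K). \<forall>f \<in> carrier (bipoly_algebra K).
        functional K \<alpha> (z \<otimes>\<^bsub>bipoly_algebra K\<^esub> f) = \<zero>\<^bsub>K\<^esub>}"

definition syntactic_algebra :: "('a, 'm) ring_scheme \<Rightarrow> 'a biseries \<Rightarrow> ('a, 'a bipoly set) module" where
  "syntactic_algebra K \<alpha> = quot_algebra (bipoly_algebra K) (syntactic_ideal K \<alpha>)"

definition poly_class :: "('a, 'm) ring_scheme \<Rightarrow> 'a biseries \<Rightarrow> 'a bipoly \<Rightarrow> 'a bipoly set" where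
  "poly_class K \<alpha> p = syntactic_ideal K \<alpha> +>\<^bsub>bipoly_algebra K\<^esub> p"

text \<open>The functional is constant on each coset of the ideal, so its image there is a singleton.\<close>

definition induced_trace :: "('a, 'm) ring_scheme \<Rightarrow> 'a biseries \<Rightarrow> 'a bipoly set \<Rightarrow> 'a" where
  "induced_trace K \<alpha> X = the_elem (functional K \<alpha> ` X)"

section \<open>Commutative Frobenius algebras with a pair of generators and a trace\<close>

definition is_trace :: "('a, 'm) ring_scheme \<Rightarrow> ('a, 'b) module \<Rightarrow> ('b \<Rightarrow> 'a) \<Rightarrow> bool" where
  "is_trace K B \<beta> \<longleftrightarrow>
     \<beta> \<in> carrier B \<rightarrow> carrier K \<and>
     (\<forall>x \<in> carrier B. \<forall>y \<in> carrier B. \<beta> (x \<oplus>\<^bsub>B\<^esub> y) = \<beta> x \<oplus>\<^bsub>K\<^esub> \<beta> y) \<and>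
     (\<forall>c \<in> carrier K. \<forall>x \<in> carrier B. \<beta> (c \<odot>\<^bsub>B\<^esub> x) = c \<otimes>\<^bsub>K\<^esub> \<beta> x)"

text \<open>Since \<open>B\<close> is commutative, the form \<open>(x, y) \<mapsto> \<beta> (x y)\<close> is symmetric and its left and
  right radicals agree.\<close>

definition nondegenerate_trace :: "('a, 'm) ring_scheme \<Rightarrow> ('a, 'b) module \<Rightarrow> ('b \<Rightarrow> 'a) \<Rightarrow> bool" where
  "nondegenerate_trace K B \<beta> \<longleftrightarrow>
     is_trace K B \<beta> \<and>
     (\<forall>x \<in> carrier B. (\<forall>y \<in> carrier B. \<beta> (x \<otimes>\<^bsub>B\<^esub> y) = \<zero>\<^bsub>K\<^esub>) \<longrightarrow> x = \<zero>\<^bsub>B\<^esub>)"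

definition comm_frobenius_algebra :: "('a, 'm) ring_scheme \<Rightarrow> ('a, 'b) module \<Rightarrow> bool" where
  "comm_frobenius_algebra K B \<longleftrightarrow>
     algebra K B \<and> finite_dim K B \<and> (\<exists>\<beta>. nondegenerate_trace K B \<beta>)"

type_synonym ('a, 'b) datum = "('a, 'b) module \<times> 'b \<times> 'b \<times> ('b \<Rightarrow> 'a)"

definition frobenius_data :: "('a, 'm) ring_scheme \<Rightarrow> ('a, 'b) datum set" where
  "frobenius_data K =
     {(B, g1, g2, \<beta>).
        comm_frobenius_algebra K B \<and> carrier B \<noteq> {\<zero>\<^bsub>B\<^esub>} \<and>
        g1 \<in> carrier B \<and> g2 \<in> carrier B \<and>
        algebra_generated K B {g1, g2} = carrier B \<and>
        nondegenerate_trace K B \<beta>}"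

fun datum_iso :: "('a, 'm) ring_scheme \<Rightarrow> ('a, 'b) datum \<Rightarrow> ('a, 'c) datum \<Rightarrow> bool" where
  "datum_iso K (B, g1, g2, \<beta>) (B', g1', g2', \<beta>') \<longleftrightarrow>
     (\<exists>\<phi> \<in> ring_iso B B'.
        (\<forall>c \<in> carrier K. \<forall>x \<in> carrier B. \<phi> (c \<odot>\<^bsub>B\<^esub> x) = c \<odot>\<^bsub>B'\<^esub> \<phi> x) \<and>
        \<phi> g1 = g1' \<and> \<phi> g2 = g2' \<and>
        (\<forall>x \<in> carrier B. \<beta>' (\<phi> x) = \<beta> x))"

definition data_isomorphism :: "('a, 'm) ring_scheme \<Rightarrow> (('a, 'b) datum \<times> ('a, 'b) datum) set" where
  "data_isomorphism K =
     {(D, D'). D \<in> frobenius_data K \<and> D' \<in> frobenius_data K \<and> datum_iso K D D'}"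

definition syntactic_datum :: "('a, 'm) ring_scheme \<Rightarrow> 'a biseries \<Rightarrow> ('a, 'a bipoly set) datum" where
  "syntactic_datum K \<alpha> =
     (syntactic_algebra K \<alpha>, poly_class K \<alpha> (T1 K), poly_class K \<alpha> (T2 K), induced_trace K \<alpha>)"

fun series_of_datum :: "('a, 'b) datum \<Rightarrow> 'a biseries" where
  "series_of_datum (B, g1, g2, \<beta>) = (\<lambda>l g. \<beta> (g1 [^]\<^bsub>B\<^esub> l \<otimes>\<^bsub>B\<^esub> g2 [^]\<^bsub>B\<^esub> g))"

end

theory Submission
  imports Defs
begin

text \<open>
  Write \<open>P = K[T\<^sub>1, T\<^sub>2]\<close>. Everything follows from the universal property of \<open>P\<close>: a pair
  \<open>(g\<^sub>1, g\<^sub>2)\<close> in a commutative algebra \<open>B\<close> is the same thing as an algebra homomorphism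
  \<open>h : P \<rightarrow> B\<close> with \<open>h T\<^sub>i = g\<^sub>i\<close>, and the pair generates \<open>B\<close> exactly when \<open>h\<close> is
  surjective. So a generated algebra is a quotient of \<open>P\<close>, and the remaining datum \<open>\<beta>\<close> has to
  determine by which ideal.

  Let \<open>\<alpha>\<close> be the series of \<open>(B, g\<^sub>1, g\<^sub>2, \<beta>)\<close>. Both \<open>p \<mapsto> \<alpha>(p)\<close> and \<open>\<beta> \<circ> h\<close> are linear
  and agree on monomials, hence \<open>\<alpha> = \<beta> \<circ> h\<close> (\<open>frobenius_data_evaluation\<close>). A polynomial \<open>p\<close>
  lies in the syntactic ideal of \<open>\<alpha>\<close> iff \<open>\<beta> (h p \<cdot> h f) = 0\<close> for all \<open>f\<close>; as \<open>h\<close> is surjective and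
  \<open>\<beta>\<close> is non-degenerate, this says \<open>h p = 0\<close> (\<open>syntactic_ideal_eq_kernel\<close>). By the first
  isomorphism theorem \<open>h\<close> induces an isomorphism from \<open>P / I\<^sub>\<alpha>\<close> to \<open>B\<close>, compatible with generators
  and traces (\<open>syntactic_datum_series_of_datum_iso\<close>). Thus a datum is recovered up to isomorphism
  from its series, and two data with the same series are isomorphic because both are isomorphic
  to the same quotient of \<open>P\<close>.

  In the other direction, the trace which \<open>\<alpha>\<close> induces on \<open>P / I\<^sub>\<alpha>\<close> is non-degenerate by the very
  definition of \<open>I\<^sub>\<alpha>\<close>, and its values on the monomials in the two generators are the coefficients
  of \<open>\<alpha>\<close>. Recognizability enters only through dimension: an ideal of finite codimension in the
  kernel of \<open>\<alpha>\<close> is contained in \<open>I\<^sub>\<alpha>\<close>, so \<open>P / I\<^sub>\<alpha>\<close> is a quotient of a finite-dimensional algebra;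
  conversely \<open>P / ker h\<close> is isomorphic to the finite-dimensional algebra \<open>B\<close>.
\<close>

section \<open>Algebra homomorphisms and quotients\<close>

definition alg_hom :: "('a, 'm) ring_scheme \<Rightarrow> ('a, 'b) module \<Rightarrow> ('a, 'c) module \<Rightarrow> ('b \<Rightarrow> 'c) set" where
  "alg_hom K B C = {h \<in> ring_hom B C. \<forall>c \<in> carrier K. \<forall>x \<in> carrier B. h (c \<odot>\<^bsub>B\<^esub> x) = c \<odot>\<^bsub>C\<^esub> h x}"

lemma alg_hom_ring_hom: "h \<in> alg_hom K B C \<Longrightarrow> h \<in> ring_hom B C"
  by (simp add: alg_hom_def)

lemma alg_hom_smult:
  "h \<in> alg_hom K B C \<Longrightarrow> c \<in> carrier K \<Longrightarrow> x \<in> carrier B \<Longrightarrow> h (c \<odot>\<^bsub>B\<^esub> x) = c \<odot>\<^bsub>C\<^esub> h x"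
  by (simp add: alg_hom_def)

lemma alg_hom_ring_hom_cring:
  assumes "algebra K B" "algebra K C" "h \<in> alg_hom K B C"
  shows "ring_hom_cring B C h"
  using assms by (auto intro!: ring_hom_cringI algebra.M_cring alg_hom_ring_hom)

text \<open>The algebras built from quotients and from iterated polynomials are records with the ring
  operations of a ring of a different record type; this lemma carries the ring laws over.\<close>

lemma cring_cong_fields:
  assumes "cring R" "carrier S = carrier R" "mult S = mult R" "one S = one R"
    "zero S = zero R" "add S = add R"
  shows "cring S"
  using assms(1)
  unfolding cring_def ring_def abelian_group_def abelian_monoid_def abelian_group_axioms_def
    comm_monoid_def comm_monoid_axioms_def ring_axioms_def monoid_def comm_group_def group_def
    group_axioms_def Units_def partial_object.simps monoid.simps assms(2-)
  .

text \<open>Scaling by \<open>c\<close> is multiplication by the ring element \<open>c \<odot> \<one>\<close>, so ring ideals are automatically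
  subspaces.\<close>

lemma (in algebra) ideal_smult_closed:
  assumes "ideal J M" "c \<in> carrier R" "j \<in> J"
  shows "c \<odot>\<^bsub>M\<^esub> j \<in> J"
proof -
  interpret J: ideal J M by fact
  have "(c \<odot>\<^bsub>M\<^esub> \<one>\<^bsub>M\<^esub>) \<otimes>\<^bsub>M\<^esub> j \<in> J"
    using assms by (intro J.I_l_closed) auto
  then show ?thesis using assms by (simp add: smult_assoc2 J.Icarr)
qed

lemma quot_algebra_carrier: "carrier (quot_algebra B J) = (\<lambda>x. J +>\<^bsub>B\<^esub> x) ` carrier B"
  by (auto simp: quot_algebra_def FactRing_def A_RCOSETS_def')

lemma quot_algebra_mult:
  assumes "ideal J B" "x \<in> carrier B" "y \<in> carrier B"
  shows "(J +>\<^bsub>B\<^esub> x) \<otimes>\<^bsub>quot_algebra B J\<^esub> (J +>\<^bsub>B\<^esub> y) = J +>\<^bsub>B\<^esub> (x \<otimes>\<^bsub>B\<^esub> y)"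
  using ideal.rcoset_mult_add[OF assms] by (simp add: quot_algebra_def FactRing_def)

lemma quot_algebra_add:
  assumes "ideal J B" "x \<in> carrier B" "y \<in> carrier B"
  shows "(J +>\<^bsub>B\<^esub> x) \<oplus>\<^bsub>quot_algebra B J\<^esub> (J +>\<^bsub>B\<^esub> y) = J +>\<^bsub>B\<^esub> (x \<oplus>\<^bsub>B\<^esub> y)"
proof -
  interpret ideal J B by fact
  show ?thesis using assms by (simp add: quot_algebra_def FactRing_def a_rcos_sum)
qed

lemma quot_algebra_one: "\<one>\<^bsub>quot_algebra B J\<^esub> = J +>\<^bsub>B\<^esub> \<one>\<^bsub>B\<^esub>"
  by (simp add: quot_algebra_def FactRing_def)

lemma ideal_coset_eq_iff:
  assumes "ideal J B" "x \<in> carrier B" "y \<in> carrier B"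
  shows "J +>\<^bsub>B\<^esub> x = J +>\<^bsub>B\<^esub> y \<longleftrightarrow> x \<ominus>\<^bsub>B\<^esub> y \<in> J"
proof -
  interpret ideal J B by fact
  show ?thesis
    unfolding a_rcos_module_minus[OF ring_axioms assms(3,2), symmetric]
    using a_repr_independence'[OF _ assms(3), of x] a_rcos_self[OF assms(2)] by auto
qed

lemma quot_algebra_zero:
  assumes "ideal J B"
  shows "\<zero>\<^bsub>quot_algebra B J\<^esub> = J +>\<^bsub>B\<^esub> \<zero>\<^bsub>B\<^esub>"
proof -
  interpret ideal J B by fact
  show ?thesis using a_coset_add_zero[OF a_subset] by (simp add: quot_algebra_def FactRing_def)
qed

lemma quot_algebra_coset_eq_zero_iff:
  assumes "ideal J B" "x \<in> carrier B"
  shows "J +>\<^bsub>B\<^esub> x = \<zero>\<^bsub>quot_algebra B J\<^esub> \<longleftrightarrow> x \<in> J"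
proof -
  interpret ideal J B by fact
  show ?thesis using assms by (simp add: quot_algebra_zero ideal_coset_eq_iff a_minus_def)
qed

text \<open>The union in the definition of the scalar action on the quotient collapses, since any two
  representatives of a coset give the same coset after scaling.\<close>

lemma quot_algebra_smult:
  assumes "algebra K B" "ideal J B" "c \<in> carrier K" "x \<in> carrier B"
  shows "c \<odot>\<^bsub>quot_algebra B J\<^esub> (J +>\<^bsub>B\<^esub> x) = J +>\<^bsub>B\<^esub> (c \<odot>\<^bsub>B\<^esub> x)"
proof -
  interpret algebra K B by fact
  interpret J: ideal J B by fact
  have "J +>\<^bsub>B\<^esub> (c \<odot>\<^bsub>B\<^esub> y) = J +>\<^bsub>B\<^esub> (c \<odot>\<^bsub>B\<^esub> x)" if y: "y \<in> J +>\<^bsub>B\<^esub> x" for y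
  proof -
    obtain j where j: "j \<in> J" "y = j \<oplus>\<^bsub>B\<^esub> x" using y by (auto simp: a_r_coset_def')
    have cj: "c \<odot>\<^bsub>B\<^esub> j \<in> J" using assms j(1) by (intro ideal_smult_closed)
    have "c \<odot>\<^bsub>B\<^esub> y = c \<odot>\<^bsub>B\<^esub> j \<oplus>\<^bsub>B\<^esub> c \<odot>\<^bsub>B\<^esub> x"
      using assms(3,4) j by (simp add: smult_r_distr J.Icarr)
    then have "c \<odot>\<^bsub>B\<^esub> y \<in> J +>\<^bsub>B\<^esub> (c \<odot>\<^bsub>B\<^esub> x)"
      using cj by (auto simp: a_r_coset_def')
    from J.a_repr_independence'[OF this] show ?thesis
      using assms(3,4) by simp
  qed
  moreover have "x \<in> J +>\<^bsub>B\<^esub> x" using assms(4) by (rule J.a_rcos_self)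
  ultimately have "(\<Union>y\<in>J +>\<^bsub>B\<^esub> x. J +>\<^bsub>B\<^esub> (c \<odot>\<^bsub>B\<^esub> y)) = J +>\<^bsub>B\<^esub> (c \<odot>\<^bsub>B\<^esub> x)"
    by blast
  then show ?thesis by (simp add: quot_algebra_def)
qed

lemma algebra_quot_algebra:
  assumes "algebra K B" "ideal J B"
  shows "algebra K (quot_algebra B J)"
proof -
  interpret algebra K B by fact
  interpret J: ideal J B by fact
  have C: "cring (quot_algebra B J)"
    by (rule cring_cong_fields[OF J.quotient_is_cring[OF M_cring]]) (simp_all add: quot_algebra_def)
  show ?thesis
    by (rule algebraI[OF R_cring C])
      (auto simp: quot_algebra_carrier quot_algebra_smult[OF assms] quot_algebra_add[OF assms(2)]
        quot_algebra_mult[OF assms(2)] smult_l_distr smult_r_distr smult_assoc1 smult_assoc2)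
qed

lemma alg_hom_quot:
  assumes "algebra K B" "ideal J B"
  shows "(\<lambda>x. J +>\<^bsub>B\<^esub> x) \<in> alg_hom K B (quot_algebra B J)"
  unfolding alg_hom_def
  using assms
  by (auto intro!: ring_hom_memI
      simp: quot_algebra_carrier quot_algebra_mult quot_algebra_add quot_algebra_one
        quot_algebra_smult[OF assms])

text \<open>The factor map serves twice: with \<open>J\<close> the kernel it gives the first isomorphism theorem, and
  with a smaller \<open>J\<close> it gives the projection from a quotient onto a coarser one.\<close>

lemma alg_hom_factor:
  assumes B: "algebra K B" and C: "algebra K C" and J: "ideal J B"
    and h: "h \<in> alg_hom K B C" and ker: "\<And>x. x \<in> J \<Longrightarrow> h x = \<zero>\<^bsub>C\<^esub>"
  obtains k where "k \<in> alg_hom K (quot_algebra B J) C" "\<And>x. x \<in> carrier B \<Longrightarrow> k (J +>\<^bsub>B\<^esub> x) = h x"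
proof -
  interpret ring_hom_cring B C h using alg_hom_ring_hom_cring[OF B C h] .
  interpret J: ideal J B by fact
  define k where "k X = the_elem (h ` X)" for X
  have k: "k (J +>\<^bsub>B\<^esub> x) = h x" if x: "x \<in> carrier B" for x
  proof -
    have "h y = h x" if y: "y \<in> J +>\<^bsub>B\<^esub> x" for y
    proof -
      obtain j where "j \<in> J" "y = j \<oplus>\<^bsub>B\<^esub> x" using y by (auto simp: a_r_coset_def')
      then show ?thesis using x by (simp add: ker J.Icarr)
    qed
    moreover have "x \<in> J +>\<^bsub>B\<^esub> x" using x by (rule J.a_rcos_self)
    ultimately have "h ` (J +>\<^bsub>B\<^esub> x) = {h x}" by blast
    then show ?thesis by (simp add: k_def)
  qed
  have "k \<in> ring_hom (quot_algebra B J) C"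
    by (rule ring_hom_memI)
      (auto simp: quot_algebra_carrier quot_algebra_mult[OF J] quot_algebra_add[OF J]
        quot_algebra_one k)
  moreover have "k (c \<odot>\<^bsub>quot_algebra B J\<^esub> X) = c \<odot>\<^bsub>C\<^esub> k X"
    if c: "c \<in> carrier K" and X: "X \<in> carrier (quot_algebra B J)" for c X
  proof -
    obtain x where x: "x \<in> carrier B" "X = J +>\<^bsub>B\<^esub> x" using X by (auto simp: quot_algebra_carrier)
    have "c \<odot>\<^bsub>B\<^esub> x \<in> carrier B"
      using c x(1) by (rule module.smult_closed[OF algebra.axioms(1)[OF B]])
    then show ?thesis
      using c x by (simp add: quot_algebra_smult[OF B J] k alg_hom_smult[OF h])
  qed
  ultimately have "k \<in> alg_hom K (quot_algebra B J) C" by (simp add: alg_hom_def)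
  with k show ?thesis using that by blast
qed

lemma alg_hom_ker_ideal:
  assumes "algebra K B" "algebra K C" "h \<in> alg_hom K B C"
  shows "ideal {x \<in> carrier B. h x = \<zero>\<^bsub>C\<^esub>} B"
proof -
  interpret ring_hom_cring B C h using alg_hom_ring_hom_cring[OF assms] .
  show ?thesis using ring.kernel_is_ideal unfolding a_kernel_def' .
qed

lemma alg_first_isomorphism:
  assumes B: "algebra K B" and C: "algebra K C"
    and h: "h \<in> alg_hom K B C" and surj: "h ` carrier B = carrier C"
    and J: "J = {x \<in> carrier B. h x = \<zero>\<^bsub>C\<^esub>}"
  obtains k where "k \<in> alg_hom K (quot_algebra B J) C"
    "bij_betw k (carrier (quot_algebra B J)) (carrier C)"
    "\<And>x. x \<in> carrier B \<Longrightarrow> k (J +>\<^bsub>B\<^esub> x) = h x"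
proof -
  interpret ring_hom_cring B C h using alg_hom_ring_hom_cring[OF B C h] .
  have I: "ideal J B" using alg_hom_ker_ideal[OF B C h] J by simp
  obtain k where k: "k \<in> alg_hom K (quot_algebra B J) C" "\<And>x. x \<in> carrier B \<Longrightarrow> k (J +>\<^bsub>B\<^esub> x) = h x"
    by (rule alg_hom_factor[OF B C I h]) (auto simp: J)
  have "x \<ominus>\<^bsub>B\<^esub> y \<in> J" if "x \<in> carrier B" "y \<in> carrier B" "h x = h y" for x y
    using that by (simp add: J R.minus_eq S.r_neg)
  then have "inj_on k (carrier (quot_algebra B J))"
    by (auto simp: inj_on_def quot_algebra_carrier k ideal_coset_eq_iff[OF I])
  moreover have "k ` carrier (quot_algebra B J) = carrier C"
    unfolding surj[symmetric] by (auto simp: quot_algebra_carrier image_iff k)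
  ultimately show ?thesis using k that by (auto simp: bij_betw_def)
qed

lemma alg_hom_inv_into:
  assumes B: "algebra K B" and C: "algebra K C"
    and h: "h \<in> alg_hom K B C" and bij: "bij_betw h (carrier B) (carrier C)"
  shows "inv_into (carrier B) h \<in> alg_hom K C B"
proof -
  interpret B: algebra K B by fact
  have iso: "h \<in> ring_iso B C" using alg_hom_ring_hom[OF h] bij unfolding ring_iso_def by blast
  have r: "inv_into (carrier B) h \<in> ring_hom C B"
    using ring_iso_set_sym[OF cring.axioms(1)[OF B.M_cring] iso] unfolding ring_iso_def mem_Collect_eq
    by (rule conjunct1)
  have "inv_into (carrier B) h (c \<odot>\<^bsub>C\<^esub> y) = c \<odot>\<^bsub>B\<^esub> inv_into (carrier B) h y"
    if "c \<in> carrier K" "y \<in> carrier C" for c y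
  proof -
    have "y \<in> h ` carrier B" using that(2) bij_betw_imp_surj_on[OF bij] by simp
    then obtain x where x: "x \<in> carrier B" "y = h x" by (elim imageE)
    have cx: "c \<odot>\<^bsub>B\<^esub> x \<in> carrier B"
      using that(1) x(1) by (rule B.smult_closed)
    have "c \<odot>\<^bsub>C\<^esub> y = h (c \<odot>\<^bsub>B\<^esub> x)"
      using alg_hom_smult[OF h that(1) x(1)] x(2) by (simp only:)
    then show ?thesis
      using bij_betw_inv_into_left[OF bij cx] bij_betw_inv_into_left[OF bij x(1)] x(2)
      by (simp only: \<open>c \<odot>\<^bsub>C\<^esub> y = h (c \<odot>\<^bsub>B\<^esub> x)\<close>)
  qed
  with r show ?thesis by (simp add: alg_hom_def)
qed

lemma alg_hom_image_subalgebra: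
  assumes B: "algebra K B" and C: "algebra K C" and h: "h \<in> alg_hom K B C"
  shows "is_subalgebra K C (h ` carrier B)"
proof -
  interpret B: algebra K B by fact
  interpret h: ring_hom_cring B C h using alg_hom_ring_hom_cring[OF B C h] .
  have "subring (h ` carrier B) C"
    using h.ring.img_is_subring[OF ring.carrier_is_subring[OF cring.axioms(1)[OF B.M_cring]]] .
  moreover have "c \<odot>\<^bsub>C\<^esub> h x \<in> h ` carrier B" if "c \<in> carrier K" "x \<in> carrier B" for c x
    unfolding alg_hom_smult[OF h that, symmetric] using that by (intro imageI B.smult_closed)
  ultimately show ?thesis by (auto simp: is_subalgebra_def)
qed

lemma alg_hom_surj_if_generated:
  assumes "algebra K B" "algebra K C" "h \<in> alg_hom K B C"
    and gen: "algebra_generated K C S = carrier C" and S: "S \<subseteq> h ` carrier B"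
  shows "h ` carrier B = carrier C"
proof -
  interpret ring_hom_cring B C h using alg_hom_ring_hom_cring[OF assms(1-3)] .
  have "carrier C \<subseteq> h ` carrier B"
    using alg_hom_image_subalgebra[OF assms(1-3)] S unfolding gen[symmetric] algebra_generated_def by blast
  then show ?thesis by auto
qed

text \<open>The preimage of a subalgebra that contains \<open>h ` S\<close> is a subalgebra that contains \<open>S\<close>, hence is
  everything.\<close>

lemma alg_hom_generated_image:
  assumes B: "algebra K B" and C: "algebra K C" and h: "h \<in> alg_hom K B C"
    and surj: "h ` carrier B = carrier C" and gen: "algebra_generated K B S = carrier B"
  shows "algebra_generated K C (h ` S) = carrier C"
proof -
  interpret B: algebra K B by fact
  interpret C: algebra K C by fact
  interpret h: ring_hom_cring B C h using alg_hom_ring_hom_cring[OF B C h] .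
  have rB: "ring B" and rC: "ring C" using B.M_cring C.M_cring by (auto simp: cring_def)
  have subB: "is_subalgebra K B (carrier B)" and subC: "is_subalgebra K C (carrier C)"
    using ring.carrier_is_subring[OF rB] ring.carrier_is_subring[OF rC] B.smult_closed C.smult_closed
    by (auto simp: is_subalgebra_def)
  have S: "S \<subseteq> carrier B" using gen unfolding algebra_generated_def by blast
  have "y \<in> T" if T: "is_subalgebra K C T" "h ` S \<subseteq> T" and y: "y \<in> carrier C" for T y
  proof -
    let ?U = "{x \<in> carrier B. h x \<in> T}"
    have rT: "subring T C" and sT: "\<And>c x. c \<in> carrier K \<Longrightarrow> x \<in> T \<Longrightarrow> c \<odot>\<^bsub>C\<^esub> x \<in> T"
      using T by (auto simp: is_subalgebra_def)
    have "subring ?U B"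
      by (rule ring.subringI[OF rB]) (auto simp: subringE(3,5,6,7)[OF rT])
    then have "is_subalgebra K B ?U"
      by (auto simp: is_subalgebra_def alg_hom_smult[OF h] sT intro: B.smult_closed)
    moreover have "S \<subseteq> ?U" using S T(2) by auto
    ultimately have U: "carrier B \<subseteq> ?U" unfolding gen[symmetric] algebra_generated_def by blast
    have "y \<in> h ` carrier B" using y surj by simp
    then show ?thesis using U by auto
  qed
  moreover have "h ` S \<subseteq> carrier C" using S by auto
  ultimately show ?thesis using subC unfolding algebra_generated_def by blast
qed

section \<open>Finite dimension of homomorphic images\<close>

context module
begin

definition lincombs :: "'c set \<Rightarrow> 'c set" where
  "lincombs S = {x. \<exists>c \<in> S \<rightarrow> carrier R. x = (\<Oplus>\<^bsub>M\<^esub>s\<in>S. c s \<odot>\<^bsub>M\<^esub> s)}"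

lemma lincombs_add:
  assumes S: "S \<subseteq> carrier M" and "x \<in> lincombs S" "y \<in> lincombs S"
  shows "x \<oplus>\<^bsub>M\<^esub> y \<in> lincombs S"
proof -
  obtain c d where c: "c \<in> S \<rightarrow> carrier R" "x = (\<Oplus>\<^bsub>M\<^esub>s\<in>S. c s \<odot>\<^bsub>M\<^esub> s)"
    and d: "d \<in> S \<rightarrow> carrier R" "y = (\<Oplus>\<^bsub>M\<^esub>s\<in>S. d s \<odot>\<^bsub>M\<^esub> s)"
    using assms by (auto simp: lincombs_def)
  have "x \<oplus>\<^bsub>M\<^esub> y = (\<Oplus>\<^bsub>M\<^esub>s\<in>S. c s \<odot>\<^bsub>M\<^esub> s \<oplus>\<^bsub>M\<^esub> d s \<odot>\<^bsub>M\<^esub> s)"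
    unfolding c(2) d(2) using c(1) d(1) S
    by (intro M.finsum_addf[symmetric]) (auto simp: Pi_iff)
  also have "\<dots> = (\<Oplus>\<^bsub>M\<^esub>s\<in>S. (c s \<oplus>\<^bsub>R\<^esub> d s) \<odot>\<^bsub>M\<^esub> s)"
    using c(1) d(1) S by (intro M.finsum_cong') (auto simp: Pi_iff smult_l_distr)
  finally show ?thesis
    using c(1) d(1) by (auto simp: lincombs_def Pi_iff intro!: bexI[of _ "\<lambda>s. c s \<oplus>\<^bsub>R\<^esub> d s"])
qed

lemma lincombs_smult:
  assumes S: "finite S" "S \<subseteq> carrier M" and a: "a \<in> carrier R" and x: "x \<in> S"
  shows "a \<odot>\<^bsub>M\<^esub> x \<in> lincombs S"
proof -
  have "(\<Oplus>\<^bsub>M\<^esub>s\<in>S. (if s = x then a else \<zero>\<^bsub>R\<^esub>) \<odot>\<^bsub>M\<^esub> s)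
      = (\<Oplus>\<^bsub>M\<^esub>s\<in>S. if x = s then a \<odot>\<^bsub>M\<^esub> s else \<zero>\<^bsub>M\<^esub>)"
    using S a by (intro M.finsum_cong') (auto simp: Pi_iff)
  also have "\<dots> = a \<odot>\<^bsub>M\<^esub> x"
    using S a x by (intro M.finsum_singleton) (auto simp: Pi_iff)
  finally show ?thesis
    using a by (auto simp: lincombs_def Pi_iff intro!: bexI[of _ "\<lambda>s. if s = x then a else \<zero>\<^bsub>R\<^esub>"])
qed

text \<open>The coefficients are indexed by \<open>i\<close>, and several \<open>i\<close> may have the same value \<open>f i\<close>. This is
  needed because a homomorphism need not be injective on a spanning set.\<close>

lemma lincombs_finsum:
  assumes S: "finite S" "S \<subseteq> carrier M" and A: "finite A"
    and c: "\<And>i. i \<in> A \<Longrightarrow> c i \<in> carrier R" and f: "\<And>i. i \<in> A \<Longrightarrow> f i \<in> S"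
  shows "(\<Oplus>\<^bsub>M\<^esub>i\<in>A. c i \<odot>\<^bsub>M\<^esub> f i) \<in> lincombs S"
  using A c f
proof (induction A rule: finite_induct)
  case empty
  have "(\<Oplus>\<^bsub>M\<^esub>s\<in>S. \<zero>\<^bsub>R\<^esub> \<odot>\<^bsub>M\<^esub> s) = (\<Oplus>\<^bsub>M\<^esub>s\<in>S. \<zero>\<^bsub>M\<^esub>)"
    using S by (intro M.finsum_cong') auto
  then have "\<zero>\<^bsub>M\<^esub> = (\<Oplus>\<^bsub>M\<^esub>s\<in>S. \<zero>\<^bsub>R\<^esub> \<odot>\<^bsub>M\<^esub> s)" by (simp add: M.finsum_zero)
  then show ?case
    by (auto simp: lincombs_def M.finsum_empty intro!: bexI[of _ "\<lambda>_. \<zero>\<^bsub>R\<^esub>"])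
next
  case (insert i A)
  have "c j \<odot>\<^bsub>M\<^esub> f j \<in> carrier M" if "j \<in> insert i A" for j
    using insert.prems that S by blast
  then have "(\<Oplus>\<^bsub>M\<^esub>i\<in>insert i A. c i \<odot>\<^bsub>M\<^esub> f i)
      = c i \<odot>\<^bsub>M\<^esub> f i \<oplus>\<^bsub>M\<^esub> (\<Oplus>\<^bsub>M\<^esub>i\<in>A. c i \<odot>\<^bsub>M\<^esub> f i)"
    using insert.hyps by (intro M.finsum_insert) auto
  moreover have "(\<Oplus>\<^bsub>M\<^esub>i\<in>A. c i \<odot>\<^bsub>M\<^esub> f i) \<in> lincombs S"
    using insert.prems by (intro insert.IH) auto
  moreover have "c i \<odot>\<^bsub>M\<^esub> f i \<in> lincombs S"
    using insert.prems S by (intro lincombs_smult) auto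
  ultimately show ?case using lincombs_add[OF S(2)] by simp
qed

end

lemma finite_dim_alg_hom_image:
  assumes B: "algebra K B" and C: "algebra K C" and h: "h \<in> alg_hom K B C"
    and surj: "h ` carrier B = carrier C" and fin: "finite_dim K B"
  shows "finite_dim K C"
proof -
  interpret B: algebra K B by fact
  interpret C: algebra K C by fact
  interpret h: ring_hom_cring B C h using alg_hom_ring_hom_cring[OF B C h] .
  obtain S where S: "finite S" "S \<subseteq> carrier B"
    and span: "\<And>x. x \<in> carrier B \<Longrightarrow> \<exists>c \<in> S \<rightarrow> carrier K. x = (\<Oplus>\<^bsub>B\<^esub>s\<in>S. c s \<odot>\<^bsub>B\<^esub> s)"
    using fin unfolding finite_dim_def by blast
  have hS: "finite (h ` S)" "h ` S \<subseteq> carrier C" using S by auto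
  have "y \<in> C.lincombs (h ` S)" if "y \<in> carrier C" for y
  proof -
    have "y \<in> h ` carrier B" using that surj by simp
    then obtain x where x: "x \<in> carrier B" "y = h x" by (elim imageE)
    obtain c where c: "c \<in> S \<rightarrow> carrier K" "x = (\<Oplus>\<^bsub>B\<^esub>s\<in>S. c s \<odot>\<^bsub>B\<^esub> s)" using span[OF x(1)] by (elim bexE)
    have cl: "(\<lambda>s. c s \<odot>\<^bsub>B\<^esub> s) \<in> S \<rightarrow> carrier B" using c(1) S(2) by (auto intro!: B.smult_closed)
    have "y = (\<Oplus>\<^bsub>C\<^esub>s\<in>S. h (c s \<odot>\<^bsub>B\<^esub> s))"
      unfolding x(2) c(2) h.ring.hom_finsum[OF cl] by (simp add: comp_def)
    also have "\<dots> = (\<Oplus>\<^bsub>C\<^esub>s\<in>S. c s \<odot>\<^bsub>C\<^esub> h s)"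
    proof (rule C.M.finsum_cong')
      show "(\<lambda>s. c s \<odot>\<^bsub>C\<^esub> h s) \<in> S \<rightarrow> carrier C" using c(1) S(2) by (auto intro!: C.smult_closed)
      show "h (c s \<odot>\<^bsub>B\<^esub> s) = c s \<odot>\<^bsub>C\<^esub> h s" if "s \<in> S" for s
        using c(1) S(2) that by (intro alg_hom_smult[OF h]) auto
    qed simp
    also have "\<dots> \<in> C.lincombs (h ` S)"
      using c(1) by (intro C.lincombs_finsum[OF hS S(1)]) auto
    finally show ?thesis .
  qed
  then show ?thesis
    unfolding finite_dim_def C.lincombs_def using hS by (intro exI[of _ "h ` S"]) simp
qed

section \<open>Polynomials in two variables\<close>

lemma (in UP_ring) UP_monom_induct [consumes 1, case_names monom add]:
  assumes p: "p \<in> carrier P"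
    and monom: "\<And>a n. a \<in> carrier R \<Longrightarrow> Q (monom P a n)"
    and add: "\<And>p q. p \<in> carrier P \<Longrightarrow> q \<in> carrier P \<Longrightarrow> Q p \<Longrightarrow> Q q \<Longrightarrow> Q (p \<oplus>\<^bsub>P\<^esub> q)"
  shows "Q p"
proof -
  have "Q (\<Oplus>\<^bsub>P\<^esub>i\<in>A. monom P (coeff P p i) i)" if "finite A" for A
    using that
  proof (induction A rule: finite_induct)
    case empty
    show ?case using monom[of "\<zero>" 0] by simp
  next
    case (insert i A)
    have "(\<Oplus>\<^bsub>P\<^esub>i\<in>insert i A. monom P (coeff P p i) i)
        = monom P (coeff P p i) i \<oplus>\<^bsub>P\<^esub> (\<Oplus>\<^bsub>P\<^esub>i\<in>A. monom P (coeff P p i) i)"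
      using insert.hyps p by (intro P.finsum_insert) auto
    moreover have "(\<Oplus>\<^bsub>P\<^esub>i\<in>A. monom P (coeff P p i) i) \<in> carrier P"
      using p by (intro P.finsum_closed) auto
    ultimately show ?case using insert.IH p by (simp add: add monom)
  qed
  from this[of "{..deg R p}"] show ?thesis using up_repr[OF p] by simp
qed

text \<open>\<open>K1\<close> and \<open>K2\<close> stand for \<open>K[T\<^sub>1]\<close> and \<open>K[T\<^sub>1][T\<^sub>2]\<close>; \<open>P\<close> is the ring \<open>K2\<close> regarded as an algebra
  over \<open>K\<close> instead of \<open>K[T\<^sub>1]\<close>.\<close>

locale bipoly = cring K for K (structure)
begin

abbreviation "K1 \<equiv> UP K"
abbreviation "K2 \<equiv> UP (UP K)"
abbreviation "P \<equiv> bipoly_algebra K"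

sublocale U: UP_cring K K1
  by (rule UP_cring.intro) (rule cring_axioms)

sublocale UU: UP_cring K1 K2
  by (rule UP_cring.intro) (rule U.UP_cring)

lemma bipoly_sel:
  "carrier P = carrier K2" "mult P = mult K2" "one P = one K2" "zero P = zero K2" "add P = add K2"
  "c \<odot>\<^bsub>P\<^esub> p = monom K1 c 0 \<odot>\<^bsub>K2\<^esub> p"
  by (simp_all add: bipoly_algebra_def)

lemma bipoly_nat_pow: "x [^]\<^bsub>P\<^esub> (n::nat) = x [^]\<^bsub>K2\<^esub> n"
  by (simp add: nat_pow_def bipoly_sel)

lemma algebra_bipoly: "algebra K P"
proof (rule algebraI)
  show "cring K" by (rule cring_axioms)
  show "cring P" by (rule cring_cong_fields[OF UU.UP_cring bipoly_sel(1-5)])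
qed (auto simp: bipoly_sel UU.UP_smult_l_distr UU.UP_smult_r_distr UU.UP_smult_assoc2
    simp flip: UU.UP_smult_assoc1 U.monom_mult)

sublocale P: algebra K P
  by (rule algebra_bipoly)

abbreviation bimonom :: "nat \<Rightarrow> nat \<Rightarrow> 'a bipoly" where
  "bimonom l g \<equiv> T1 K [^]\<^bsub>P\<^esub> l \<otimes>\<^bsub>P\<^esub> T2 K [^]\<^bsub>P\<^esub> g"

lemma T1_closed: "T1 K \<in> carrier P" and T2_closed: "T2 K \<in> carrier P"
  by (simp_all add: T1_def T2_def bipoly_sel)

lemma bimonom_closed: "bimonom l g \<in> carrier P"
  using T1_closed T2_closed P.nat_pow_closed P.m_closed by blast

lemma smult_bimonom:
  assumes "c \<in> carrier K"
  shows "c \<odot>\<^bsub>P\<^esub> bimonom l g = monom K2 (monom K1 c l) g"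
proof -
  have "T1 K [^]\<^bsub>K2\<^esub> l = monom K2 (monom K1 \<one> l) 0"
    by (simp add: T1_def UU.monom_pow U.monom_pow)
  moreover have "T2 K [^]\<^bsub>K2\<^esub> g = monom K2 \<one>\<^bsub>K1\<^esub> g"
    by (simp add: T2_def UU.monom_pow)
  ultimately have "bimonom l g = monom K2 (monom K1 \<one> l) g"
    using UU.monom_mult[of "monom K1 \<one> l" "\<one>\<^bsub>K1\<^esub>" 0 g] by (simp add: bipoly_nat_pow bipoly_sel)
  then have "c \<odot>\<^bsub>P\<^esub> bimonom l g = monom K2 (monom K1 c 0 \<otimes>\<^bsub>K1\<^esub> monom K1 \<one> l) g"
    using assms by (simp add: bipoly_sel UU.monom_mult_smult)
  then show ?thesis using assms U.monom_mult[of c \<one> 0 l] by simp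
qed

text \<open>Scaled monomials span \<open>P\<close> additively. The case of the zero polynomial is covered by the scalar
  \<open>c = 0\<close>. All identities between linear maps on \<open>P\<close> below are checked on monomials this way.\<close>

lemma bipoly_induct [consumes 1, case_names monom add]:
  assumes p: "p \<in> carrier P"
    and monom: "\<And>c l g. c \<in> carrier K \<Longrightarrow> Q (c \<odot>\<^bsub>P\<^esub> bimonom l g)"
    and add: "\<And>p q. p \<in> carrier P \<Longrightarrow> q \<in> carrier P \<Longrightarrow> Q p \<Longrightarrow> Q q \<Longrightarrow> Q (p \<oplus>\<^bsub>P\<^esub> q)"
  shows "Q p"
proof (rule UU.UP_monom_induct)
  show "p \<in> carrier K2" using p by (simp add: bipoly_sel)
  show "Q (monom K2 a g)" if "a \<in> carrier K1" for a g
  proof (rule U.UP_monom_induct[OF that])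
    show "Q (monom K2 (monom K1 c l) g)" if "c \<in> carrier K" for c l
      using monom[OF that, of l g] that by (simp add: smult_bimonom)
    show "Q (monom K2 (a \<oplus>\<^bsub>K1\<^esub> b) g)"
      if "a \<in> carrier K1" "b \<in> carrier K1" "Q (monom K2 a g)" "Q (monom K2 b g)" for a b
      using add[of "monom K2 a g" "monom K2 b g"] that by (simp add: bipoly_sel)
  qed
  show "Q (p \<oplus>\<^bsub>K2\<^esub> q)" if "p \<in> carrier K2" "q \<in> carrier K2" "Q p" "Q q" for p q
    using add[of p q] that by (simp add: bipoly_sel)
qed

lemma algebra_generated_bipoly: "algebra_generated K P {T1 K, T2 K} = carrier P"
proof -
  have "p \<in> S" if p: "p \<in> carrier P" and S: "is_subalgebra K P S" "{T1 K, T2 K} \<subseteq> S" for p S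
  proof -
    have r: "subring S P" and sm: "\<And>c x. c \<in> carrier K \<Longrightarrow> x \<in> S \<Longrightarrow> c \<odot>\<^bsub>P\<^esub> x \<in> S"
      using S by (auto simp: is_subalgebra_def)
    have pow: "x [^]\<^bsub>P\<^esub> (n::nat) \<in> S" if "x \<in> S" for x n
      using subringE(3,6)[OF r] that by (induction n) auto
    from p show ?thesis
    proof (induction rule: bipoly_induct)
      case (monom c l g)
      then show ?case using S(2) by (intro sm subringE(6)[OF r] pow) auto
    next
      case (add p q)
      then show ?case by (intro subringE(7)[OF r])
    qed
  qed
  moreover have "is_subalgebra K P (carrier P)"
    using ring.carrier_is_subring[OF cring.axioms(1)[OF P.M_cring]] P.smult_closed
    by (auto simp: is_subalgebra_def)
  ultimately show ?thesis
    using T1_closed T2_closed unfolding algebra_generated_def by blast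
qed

text \<open>The universal property of \<open>K[T\<^sub>1, T\<^sub>2]\<close>, from that of univariate polynomials used twice: the
  structure map \<open>c \<mapsto> c \<odot> \<one>\<close> is extended to \<open>K[T\<^sub>1]\<close> by \<open>T\<^sub>1 \<mapsto> g1\<close>, and the result to
  \<open>K[T\<^sub>1][T\<^sub>2]\<close> by \<open>T\<^sub>2 \<mapsto> g2\<close>.\<close>

lemma bipoly_evaluation:
  assumes B: "algebra K B" and g1: "g1 \<in> carrier B" and g2: "g2 \<in> carrier B"
  obtains h where "h \<in> alg_hom K P B" "h (T1 K) = g1" "h (T2 K) = g2"
proof -
  interpret B: algebra K B by fact
  define \<phi> where "\<phi> c = c \<odot>\<^bsub>B\<^esub> \<one>\<^bsub>B\<^esub>" for c
  have phi_mult: "\<phi> c \<otimes>\<^bsub>B\<^esub> x = c \<odot>\<^bsub>B\<^esub> x" if "c \<in> carrier K" "x \<in> carrier B" for c x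
    using that by (simp add: \<phi>_def B.smult_assoc2)
  have "\<phi> \<in> ring_hom K B"
  proof (rule ring_hom_memI)
    show "\<phi> (c \<otimes> d) = \<phi> c \<otimes>\<^bsub>B\<^esub> \<phi> d" if "c \<in> carrier K" "d \<in> carrier K" for c d
      using that phi_mult[of c "\<phi> d"] by (simp add: \<phi>_def B.smult_assoc1)
  qed (auto simp: \<phi>_def B.smult_l_distr)
  then interpret E1: UP_pre_univ_prop K B \<phi> K1
    by (intro UP_pre_univ_prop.intro ring_hom_cringI cring_axioms B.M_cring U.UP_cring_axioms)
  define e1 where "e1 = eval K B \<phi> g1"
  have "e1 \<in> ring_hom K1 B" unfolding e1_def using g1 by (rule E1.eval_ring_hom)
  then interpret E2: UP_pre_univ_prop K1 B e1 K2
    by (intro UP_pre_univ_prop.intro ring_hom_cringI U.UP_cring B.M_cring UU.UP_cring_axioms)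
  define h where "h = eval K1 B e1 g2"
  have h: "h \<in> ring_hom K2 B" unfolding h_def using g2 by (rule E2.eval_ring_hom)
  have hconst: "h (monom K2 a 0) = e1 a" if "a \<in> carrier K1" for a
    unfolding h_def using g2 that by (rule E2.eval_const)
  have e1const: "e1 (monom K1 c 0) = \<phi> c" if "c \<in> carrier K" for c
    unfolding e1_def using g1 that by (rule E1.eval_const)
  have "h (c \<odot>\<^bsub>P\<^esub> p) = c \<odot>\<^bsub>B\<^esub> h p" if c: "c \<in> carrier K" and p: "p \<in> carrier P" for c p
  proof -
    have "p \<in> carrier K2" using p by (simp add: bipoly_sel)
    then have "h (c \<odot>\<^bsub>P\<^esub> p) = h (monom K2 (monom K1 c 0) 0 \<otimes>\<^bsub>K2\<^esub> p)"
      using c by (simp add: bipoly_sel UU.monom_mult_is_smult)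
    also have "\<dots> = \<phi> c \<otimes>\<^bsub>B\<^esub> h p"
      using ring_hom_mult[OF h] c \<open>p \<in> carrier K2\<close> by (simp add: hconst e1const)
    also have "\<dots> = c \<odot>\<^bsub>B\<^esub> h p"
      using c ring_hom_closed[OF h \<open>p \<in> carrier K2\<close>] by (rule phi_mult)
    finally show ?thesis .
  qed
  moreover have "h \<in> ring_hom P B" using h by (simp add: ring_hom_def bipoly_sel)
  moreover have "h (T1 K) = g1"
    unfolding T1_def using E1.eval_monom1[OF g1] by (simp add: hconst e1_def)
  moreover have "h (T2 K) = g2"
    unfolding T2_def h_def by (rule E2.eval_monom1[OF g2])
  ultimately show ?thesis by (intro that[of h]) (simp_all add: alg_hom_def)
qed

lemma bicoeff_closed: "p \<in> carrier P \<Longrightarrow> bicoeff K p l g \<in> carrier K"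
  by (simp add: bicoeff_def bipoly_sel)

lemma bicoeff_add:
  "p \<in> carrier P \<Longrightarrow> q \<in> carrier P \<Longrightarrow> bicoeff K (p \<oplus>\<^bsub>P\<^esub> q) l g = bicoeff K p l g \<oplus> bicoeff K q l g"
  by (simp add: bicoeff_def bipoly_sel)

lemma bicoeff_smult_bimonom:
  "c \<in> carrier K \<Longrightarrow> bicoeff K (c \<odot>\<^bsub>P\<^esub> bimonom l g) i j = (if i = l \<and> j = g then c else \<zero>)"
  by (simp add: bicoeff_def smult_bimonom)

abbreviation support :: "'a bipoly \<Rightarrow> (nat \<times> nat) set" where
  "support p \<equiv> {(l, g). bicoeff K p l g \<noteq> \<zero>}"

lemma finite_support: "p \<in> carrier P \<Longrightarrow> finite (support p)"
proof (induction rule: bipoly_induct)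
  case (monom c l g)
  then have "support (c \<odot>\<^bsub>P\<^esub> bimonom l g) \<subseteq> {(l, g)}" by (auto simp: bicoeff_smult_bimonom split: if_splits)
  then show ?case by (rule finite_subset) simp
next
  case (add p q)
  then have "support (p \<oplus>\<^bsub>P\<^esub> q) \<subseteq> support p \<union> support q" by (auto simp: bicoeff_add)
  then show ?case using add by (auto intro: finite_subset)
qed

text \<open>Summing over any finite set that contains the support, instead of the support itself, allows
  one common index set for \<open>p\<close>, \<open>q\<close> and \<open>p \<oplus> q\<close>.\<close>

lemma functional_eq:
  assumes al: "\<alpha> \<in> biseries K" and p: "p \<in> carrier P" and F: "finite F" "support p \<subseteq> F"
  shows "functional K \<alpha> p = (\<Oplus>i\<in>F. bicoeff K p (fst i) (snd i) \<otimes> \<alpha> (fst i) (snd i))"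
  unfolding functional_def case_prod_beta using assms bicoeff_closed[OF p]
  by (intro add.finprod_mono_neutral_cong_left) (auto simp: biseries_def)

lemma functional_smult_bimonom:
  assumes al: "\<alpha> \<in> biseries K" and c: "c \<in> carrier K"
  shows "functional K \<alpha> (c \<odot>\<^bsub>P\<^esub> bimonom l g) = c \<otimes> \<alpha> l g"
proof -
  have "functional K \<alpha> (c \<odot>\<^bsub>P\<^esub> bimonom l g)
     = (\<Oplus>i\<in>{(l, g)}. bicoeff K (c \<odot>\<^bsub>P\<^esub> bimonom l g) (fst i) (snd i) \<otimes> \<alpha> (fst i) (snd i))"
    using c by (intro functional_eq[OF al] P.smult_closed bimonom_closed)
      (auto simp: bicoeff_smult_bimonom split: if_splits)
  also have "\<dots> = c \<otimes> \<alpha> l g"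
    using c al by (simp add: bicoeff_smult_bimonom biseries_def)
  finally show ?thesis .
qed

lemma functional_bimonom: "\<alpha> \<in> biseries K \<Longrightarrow> functional K \<alpha> (bimonom l g) = \<alpha> l g"
  using functional_smult_bimonom[of \<alpha> \<one> l g] P.smult_one[OF bimonom_closed, of l g]
  by (simp add: biseries_def)

lemma functional_add:
  assumes al: "\<alpha> \<in> biseries K" and p: "p \<in> carrier P" and q: "q \<in> carrier P"
  shows "functional K \<alpha> (p \<oplus>\<^bsub>P\<^esub> q) = functional K \<alpha> p \<oplus> functional K \<alpha> q"
proof -
  let ?F = "support p \<union> support q"
  let ?t = "\<lambda>p i. bicoeff K p (fst i) (snd i) \<otimes> \<alpha> (fst i) (snd i)"
  have F: "finite ?F" using finite_support p q by simp
  have al': "\<alpha> l g \<in> carrier K" for l g using al by (simp add: biseries_def)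
  have "functional K \<alpha> (p \<oplus>\<^bsub>P\<^esub> q) = (\<Oplus>i\<in>?F. ?t (p \<oplus>\<^bsub>P\<^esub> q) i)"
    using p q by (intro functional_eq[OF al _ F] P.a_closed) (auto simp: bicoeff_add)
  also have "\<dots> = (\<Oplus>i\<in>?F. ?t p i \<oplus> ?t q i)"
    using p q al' by (intro finsum_cong') (auto simp: bicoeff_add bicoeff_closed l_distr)
  also have "\<dots> = (\<Oplus>i\<in>?F. ?t p i) \<oplus> (\<Oplus>i\<in>?F. ?t q i)"
    using p q al' by (intro finsum_addf) (auto simp: bicoeff_closed)
  also have "\<dots> = functional K \<alpha> p \<oplus> functional K \<alpha> q"
    using functional_eq[OF al p F] functional_eq[OF al q F] by simp
  finally show ?thesis .
qed

lemma functional_closed: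
  assumes al: "\<alpha> \<in> biseries K" and p: "p \<in> carrier P"
  shows "functional K \<alpha> p \<in> carrier K"
  using p
  by (induction rule: bipoly_induct)
    (use al in \<open>auto simp: functional_add functional_smult_bimonom biseries_def\<close>)

lemma functional_smult:
  assumes al: "\<alpha> \<in> biseries K" and c: "c \<in> carrier K" and p: "p \<in> carrier P"
  shows "functional K \<alpha> (c \<odot>\<^bsub>P\<^esub> p) = c \<otimes> functional K \<alpha> p"
  using p
proof (induction rule: bipoly_induct)
  case (monom d l g)
  have "c \<odot>\<^bsub>P\<^esub> (d \<odot>\<^bsub>P\<^esub> bimonom l g) = (c \<otimes> d) \<odot>\<^bsub>P\<^esub> bimonom l g"
    using P.smult_assoc1[OF c monom bimonom_closed] by simp
  then show ?case
    using monom c al by (simp add: functional_smult_bimonom biseries_def m_assoc)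
next
  case (add p q)
  then show ?case
    using c by (simp add: P.smult_r_distr functional_add[OF al] functional_closed[OF al] r_distr P.smult_closed)
qed

end

section \<open>The syntactic algebra of a series\<close>

context bipoly
begin

context
  fixes \<alpha> :: "'a biseries"
  assumes al: "\<alpha> \<in> biseries K"
begin

lemma functional_zero: "functional K \<alpha> \<zero>\<^bsub>P\<^esub> = \<zero>"
  using functional_smult[OF al zero_closed P.one_closed] functional_closed[OF al P.one_closed]
  by simp

lemma ideal_syntactic_ideal: "ideal (syntactic_ideal K \<alpha>) P"
proof (rule idealI)
  show "ring P" using P.M_cring by (simp add: cring_def)
  show "subgroup (syntactic_ideal K \<alpha>) (add_monoid P)"
  proof (rule P.add.subgroupI)
    show "syntactic_ideal K \<alpha> \<noteq> {}"
      using P.l_null functional_zero by (auto simp: syntactic_ideal_def intro!: exI[of _ "\<zero>\<^bsub>P\<^esub>"])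
    show "\<ominus>\<^bsub>P\<^esub> x \<in> syntactic_ideal K \<alpha>" if "x \<in> syntactic_ideal K \<alpha>" for x
    proof -
      have "functional K \<alpha> (\<ominus>\<^bsub>P\<^esub> x \<otimes>\<^bsub>P\<^esub> f) = \<zero>" if f: "f \<in> carrier P" for f
      proof -
        have "\<ominus>\<^bsub>P\<^esub> x \<otimes>\<^bsub>P\<^esub> f = x \<otimes>\<^bsub>P\<^esub> (\<ominus>\<^bsub>P\<^esub> f)"
          using \<open>x \<in> _\<close> f by (simp add: syntactic_ideal_def P.l_minus P.r_minus)
        then show ?thesis using \<open>x \<in> _\<close> f by (simp add: syntactic_ideal_def)
      qed
      then show ?thesis using that by (simp add: syntactic_ideal_def)
    qed
  qed (auto simp: syntactic_ideal_def P.l_distr functional_add[OF al])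
  show "x \<otimes>\<^bsub>P\<^esub> z \<in> syntactic_ideal K \<alpha>" "z \<otimes>\<^bsub>P\<^esub> x \<in> syntactic_ideal K \<alpha>"
    if z: "z \<in> syntactic_ideal K \<alpha>" and x: "x \<in> carrier P" for z x
  proof -
    show "z \<otimes>\<^bsub>P\<^esub> x \<in> syntactic_ideal K \<alpha>"
      using z x by (simp add: syntactic_ideal_def P.m_assoc)
    moreover have "x \<otimes>\<^bsub>P\<^esub> z = z \<otimes>\<^bsub>P\<^esub> x"
      using z x by (intro P.m_comm) (simp_all add: syntactic_ideal_def)
    ultimately show "x \<otimes>\<^bsub>P\<^esub> z \<in> syntactic_ideal K \<alpha>" by simp
  qed
qed

lemma functional_syntactic_ideal:
  assumes "z \<in> syntactic_ideal K \<alpha>"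
  shows "functional K \<alpha> z = \<zero>"
proof -
  have z: "z \<in> carrier P" and "\<forall>f \<in> carrier P. functional K \<alpha> (z \<otimes>\<^bsub>P\<^esub> f) = \<zero>"
    using assms by (simp_all add: syntactic_ideal_def)
  from this(2) P.one_closed have "functional K \<alpha> (z \<otimes>\<^bsub>P\<^esub> \<one>\<^bsub>P\<^esub>) = \<zero>" by (rule bspec)
  then show ?thesis using z by simp
qed

text \<open>An ideal \<open>J\<close> in the kernel contains \<open>z \<otimes> f\<close> along with \<open>z\<close>. Hence the syntactic ideal is the
  largest ideal in the kernel.\<close>

lemma ideal_subset_syntactic_ideal:
  assumes J: "ideal J P" and ker: "J \<subseteq> functional_kernel K \<alpha>"
  shows "J \<subseteq> syntactic_ideal K \<alpha>"
proof
  fix z assume z: "z \<in> J"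
  have "z \<in> carrier P" using ker z by (auto simp: functional_kernel_def)
  moreover have "z \<otimes>\<^bsub>P\<^esub> f \<in> J" if "f \<in> carrier P" for f
    using ideal.I_r_closed[OF J z that] .
  ultimately show "z \<in> syntactic_ideal K \<alpha>"
    using ker by (auto simp: syntactic_ideal_def functional_kernel_def)
qed

lemma algebra_syntactic_algebra: "algebra K (syntactic_algebra K \<alpha>)"
  unfolding syntactic_algebra_def by (rule algebra_quot_algebra[OF algebra_bipoly ideal_syntactic_ideal])

lemma poly_class_alg_hom: "poly_class K \<alpha> \<in> alg_hom K P (syntactic_algebra K \<alpha>)"
  using alg_hom_quot[OF algebra_bipoly ideal_syntactic_ideal]
  unfolding syntactic_algebra_def poly_class_def[abs_def] .

lemma carrier_syntactic_algebra: "carrier (syntactic_algebra K \<alpha>) = poly_class K \<alpha> ` carrier P"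
  unfolding syntactic_algebra_def quot_algebra_carrier poly_class_def ..

lemma poly_class_eq_zero_iff:
  "p \<in> carrier P \<Longrightarrow> poly_class K \<alpha> p = \<zero>\<^bsub>syntactic_algebra K \<alpha>\<^esub> \<longleftrightarrow> p \<in> syntactic_ideal K \<alpha>"
  unfolding syntactic_algebra_def poly_class_def
  by (rule quot_algebra_coset_eq_zero_iff[OF ideal_syntactic_ideal])

lemma induced_trace_poly_class:
  assumes p: "p \<in> carrier P"
  shows "induced_trace K \<alpha> (poly_class K \<alpha> p) = functional K \<alpha> p"
proof -
  interpret I: ideal "syntactic_ideal K \<alpha>" P by (rule ideal_syntactic_ideal)
  have "functional K \<alpha> q = functional K \<alpha> p" if q: "q \<in> poly_class K \<alpha> p" for q
  proof -
    obtain i where i: "i \<in> syntactic_ideal K \<alpha>" "q = i \<oplus>\<^bsub>P\<^esub> p"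
      using q by (auto simp: poly_class_def a_r_coset_def')
    then show ?thesis
      using functional_add[OF al I.Icarr[OF i(1)] p] functional_syntactic_ideal[OF i(1)]
        functional_closed[OF al p] by simp
  qed
  moreover have "p \<in> poly_class K \<alpha> p"
    unfolding poly_class_def using p by (rule I.a_rcos_self)
  ultimately have "functional K \<alpha> ` poly_class K \<alpha> p = {functional K \<alpha> p}" by blast
  then show ?thesis by (simp add: induced_trace_def)
qed

text \<open>A class in the radical of the trace form is represented by some \<open>p\<close> with \<open>\<alpha> (p f) = 0\<close> for all
  \<open>f\<close>, that is, by an element of the syntactic ideal.\<close>

lemma nondegenerate_induced_trace:
  "nondegenerate_trace K (syntactic_algebra K \<alpha>) (induced_trace K \<alpha>)"
proof -
  interpret q: ring_hom_cring P "syntactic_algebra K \<alpha>" "poly_class K \<alpha>"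
    using alg_hom_ring_hom_cring[OF algebra_bipoly algebra_syntactic_algebra poly_class_alg_hom] .
  have add: "induced_trace K \<alpha> (poly_class K \<alpha> p \<oplus>\<^bsub>syntactic_algebra K \<alpha>\<^esub> poly_class K \<alpha> q)
      = functional K \<alpha> p \<oplus> functional K \<alpha> q" if "p \<in> carrier P" "q \<in> carrier P" for p q
    unfolding q.hom_add[OF that, symmetric]
    using that by (simp only: P.a_closed induced_trace_poly_class functional_add[OF al])
  have mult: "induced_trace K \<alpha> (poly_class K \<alpha> p \<otimes>\<^bsub>syntactic_algebra K \<alpha>\<^esub> poly_class K \<alpha> q)
      = functional K \<alpha> (p \<otimes>\<^bsub>P\<^esub> q)" if "p \<in> carrier P" "q \<in> carrier P" for p q
    unfolding q.hom_mult[OF that, symmetric]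
    using that by (simp only: P.m_closed induced_trace_poly_class)
  have smult: "induced_trace K \<alpha> (c \<odot>\<^bsub>syntactic_algebra K \<alpha>\<^esub> poly_class K \<alpha> p) = c \<otimes> functional K \<alpha> p"
    if "c \<in> carrier K" "p \<in> carrier P" for c p
    unfolding alg_hom_smult[OF poly_class_alg_hom that, symmetric]
    using that by (simp only: P.smult_closed induced_trace_poly_class functional_smult[OF al])
  have "is_trace K (syntactic_algebra K \<alpha>) (induced_trace K \<alpha>)"
    unfolding is_trace_def carrier_syntactic_algebra
    by (auto simp: add smult induced_trace_poly_class functional_closed[OF al])
  moreover have "poly_class K \<alpha> p = \<zero>\<^bsub>syntactic_algebra K \<alpha>\<^esub>"
    if p: "p \<in> carrier P"
      and ann: "\<forall>Y \<in> carrier (syntactic_algebra K \<alpha>).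
        induced_trace K \<alpha> (poly_class K \<alpha> p \<otimes>\<^bsub>syntactic_algebra K \<alpha>\<^esub> Y) = \<zero>" for p
  proof -
    have "p \<in> syntactic_ideal K \<alpha>"
      using ann p by (auto simp: syntactic_ideal_def carrier_syntactic_algebra mult)
    then show ?thesis using p by (simp add: poly_class_eq_zero_iff)
  qed
  ultimately show ?thesis
    unfolding nondegenerate_trace_def by (simp add: carrier_syntactic_algebra)
qed

lemma series_of_syntactic_datum: "series_of_datum (syntactic_datum K \<alpha>) = \<alpha>"
proof (intro ext)
  fix l g
  interpret q: ring_hom_cring P "syntactic_algebra K \<alpha>" "poly_class K \<alpha>"
    using alg_hom_ring_hom_cring[OF algebra_bipoly algebra_syntactic_algebra poly_class_alg_hom] .
  have "poly_class K \<alpha> (T1 K) [^]\<^bsub>syntactic_algebra K \<alpha>\<^esub> l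
        \<otimes>\<^bsub>syntactic_algebra K \<alpha>\<^esub> poly_class K \<alpha> (T2 K) [^]\<^bsub>syntactic_algebra K \<alpha>\<^esub> g
      = poly_class K \<alpha> (bimonom l g)"
    using T1_closed T2_closed by (simp add: P.nat_pow_closed)
  then show "series_of_datum (syntactic_datum K \<alpha>) l g = \<alpha> l g"
    by (simp add: syntactic_datum_def induced_trace_poly_class bimonom_closed functional_bimonom al)
qed

end

text \<open>The syntactic algebra is a quotient of \<open>P / J\<close> for the ideal \<open>J\<close> of finite codimension.\<close>

lemma finite_dim_syntactic_algebra:
  assumes rec: "recognizable K \<alpha>"
  shows "finite_dim K (syntactic_algebra K \<alpha>)"
proof -
  have al: "\<alpha> \<in> biseries K" using rec by (simp add: recognizable_def)
  obtain J where J: "ideal J P" "J \<subseteq> functional_kernel K \<alpha>" and fin: "finite_dim K (quot_algebra P J)"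
    using rec by (auto simp: recognizable_def)
  have "poly_class K \<alpha> z = \<zero>\<^bsub>syntactic_algebra K \<alpha>\<^esub>" if "z \<in> J" for z
  proof -
    have "z \<in> syntactic_ideal K \<alpha>" using ideal_subset_syntactic_ideal[OF al J] that by (rule subsetD)
    moreover have "z \<in> carrier P" using ideal.Icarr[OF J(1) that] .
    ultimately show ?thesis by (simp add: poly_class_eq_zero_iff[OF al])
  qed
  then obtain k where k: "k \<in> alg_hom K (quot_algebra P J) (syntactic_algebra K \<alpha>)"
      "\<And>p. p \<in> carrier P \<Longrightarrow> k (J +>\<^bsub>P\<^esub> p) = poly_class K \<alpha> p"
    using alg_hom_factor[OF algebra_bipoly algebra_syntactic_algebra[OF al] J(1) poly_class_alg_hom[OF al]]
    by blast
  have "k ` carrier (quot_algebra P J) = carrier (syntactic_algebra K \<alpha>)"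
    by (simp add: quot_algebra_carrier carrier_syntactic_algebra[OF al] image_image k(2))
  then show ?thesis
    by (intro finite_dim_alg_hom_image[OF algebra_quot_algebra[OF algebra_bipoly J(1)]
        algebra_syntactic_algebra[OF al] k(1) _ fin])
qed

lemma syntactic_datum_frobenius:
  assumes "\<alpha> \<in> nonzero_recognizable K"
  shows "syntactic_datum K \<alpha> \<in> frobenius_data K"
proof -
  have rec: "recognizable K \<alpha>" and al: "\<alpha> \<in> biseries K"
    using assms by (auto simp: nonzero_recognizable_def recognizable_def)
  obtain l g where lg: "\<alpha> l g \<noteq> \<zero>" using assms by (auto simp: nonzero_recognizable_def)
  have "bimonom l g \<notin> syntactic_ideal K \<alpha>"
    using functional_syntactic_ideal[OF al] functional_bimonom[OF al] lg by metis
  then have "poly_class K \<alpha> (bimonom l g) \<noteq> \<zero>\<^bsub>syntactic_algebra K \<alpha>\<^esub>"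
    using poly_class_eq_zero_iff[OF al bimonom_closed] by simp
  moreover have "poly_class K \<alpha> (bimonom l g) \<in> carrier (syntactic_algebra K \<alpha>)"
    unfolding carrier_syntactic_algebra[OF al] by (rule imageI[OF bimonom_closed])
  ultimately have "carrier (syntactic_algebra K \<alpha>) \<noteq> {\<zero>\<^bsub>syntactic_algebra K \<alpha>\<^esub>}"
    by (metis singletonD)
  moreover have "algebra_generated K (syntactic_algebra K \<alpha>) {poly_class K \<alpha> (T1 K), poly_class K \<alpha> (T2 K)}
      = carrier (syntactic_algebra K \<alpha>)"
    using alg_hom_generated_image[OF algebra_bipoly algebra_syntactic_algebra[OF al]
        poly_class_alg_hom[OF al] carrier_syntactic_algebra[OF al, symmetric] algebra_generated_bipoly]
    by simp
  ultimately show ?thesis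
    using algebra_syntactic_algebra[OF al] finite_dim_syntactic_algebra[OF rec]
      nondegenerate_induced_trace[OF al] T1_closed T2_closed
    by (auto simp: syntactic_datum_def frobenius_data_def comm_frobenius_algebra_def
        carrier_syntactic_algebra[OF al])
qed

end

section \<open>The series of a Frobenius datum\<close>

context bipoly
begin

text \<open>The series of a datum, viewed as a functional on \<open>P\<close>, is the trace pulled back along evaluation
  at the generators.\<close>

lemma frobenius_data_evaluation:
  assumes D: "(B, g1, g2, \<beta>) \<in> frobenius_data K"
  obtains h where "h \<in> alg_hom K P B" "h (T1 K) = g1" "h (T2 K) = g2" "h ` carrier P = carrier B"
    "series_of_datum (B, g1, g2, \<beta>) \<in> biseries K"
    "\<And>p. p \<in> carrier P \<Longrightarrow> functional K (series_of_datum (B, g1, g2, \<beta>)) p = \<beta> (h p)"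
proof -
  have B: "algebra K B" and g: "g1 \<in> carrier B" "g2 \<in> carrier B"
    and gen: "algebra_generated K B {g1, g2} = carrier B" and tr: "is_trace K B \<beta>"
    using D by (auto simp: frobenius_data_def comm_frobenius_algebra_def nondegenerate_trace_def)
  interpret B: algebra K B by fact
  obtain h where h: "h \<in> alg_hom K P B" "h (T1 K) = g1" "h (T2 K) = g2"
    using bipoly_evaluation[OF B g] .
  interpret h: ring_hom_cring P B h using alg_hom_ring_hom_cring[OF algebra_bipoly B h(1)] .
  let ?\<alpha> = "series_of_datum (B, g1, g2, \<beta>)"
  have "{g1, g2} \<subseteq> h ` carrier P" using T1_closed T2_closed h(2,3) by auto
  then have surj: "h ` carrier P = carrier B"
    by (rule alg_hom_surj_if_generated[OF algebra_bipoly B h(1) gen])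
  have hm: "h (bimonom l k) = g1 [^]\<^bsub>B\<^esub> l \<otimes>\<^bsub>B\<^esub> g2 [^]\<^bsub>B\<^esub> k" for l k
    using T1_closed T2_closed h(2,3) by (simp add: P.nat_pow_closed)
  have al: "?\<alpha> \<in> biseries K"
    using tr h.hom_closed[OF bimonom_closed] by (auto simp: biseries_def is_trace_def hm)
  have "functional K ?\<alpha> p = \<beta> (h p)" if "p \<in> carrier P" for p
    using that
  proof (induction rule: bipoly_induct)
    case (monom c l k)
    have "\<beta> (h (c \<odot>\<^bsub>P\<^esub> bimonom l k)) = c \<otimes> \<beta> (h (bimonom l k))"
      unfolding alg_hom_smult[OF h(1) monom bimonom_closed]
      using tr monom h.hom_closed[OF bimonom_closed] by (simp add: is_trace_def)
    then show ?case using functional_smult_bimonom[OF al monom] by (simp add: hm)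
  next
    case (add p q)
    then show ?case using tr functional_add[OF al] by (simp add: is_trace_def)
  qed
  then show ?thesis by (intro that[OF h surj al])
qed

text \<open>The kernel of the evaluation map witnesses recognizability. If the series were zero, then \<open>\<beta>\<close>
  would vanish on the image of the evaluation map, which is all of \<open>B\<close>, contradicting
  non-degeneracy on a nonzero algebra.\<close>

lemma series_of_datum_nonzero_recognizable:
  assumes "D \<in> frobenius_data K"
  shows "series_of_datum D \<in> nonzero_recognizable K"
proof -
  obtain B g1 g2 \<beta> where D: "D = (B, g1, g2, \<beta>)" by (cases D)
  have B: "algebra K B" and fin: "finite_dim K B" and nz: "carrier B \<noteq> {\<zero>\<^bsub>B\<^esub>}"
    and tr: "is_trace K B \<beta>"
    and nd: "\<And>x. x \<in> carrier B \<Longrightarrow> \<forall>y \<in> carrier B. \<beta> (x \<otimes>\<^bsub>B\<^esub> y) = \<zero> \<Longrightarrow> x = \<zero>\<^bsub>B\<^esub>"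
    using assms D by (auto simp: frobenius_data_def comm_frobenius_algebra_def nondegenerate_trace_def)
  interpret B: algebra K B by fact
  obtain h where h: "h \<in> alg_hom K P B" "h ` carrier P = carrier B" and al: "series_of_datum D \<in> biseries K"
    and fh: "\<And>p. p \<in> carrier P \<Longrightarrow> functional K (series_of_datum D) p = \<beta> (h p)"
    using frobenius_data_evaluation[of B g1 g2 \<beta>] assms D by metis
  define J where "J = {x \<in> carrier P. h x = \<zero>\<^bsub>B\<^esub>}"
  have J: "ideal J P" unfolding J_def by (rule alg_hom_ker_ideal[OF algebra_bipoly B h(1)])
  obtain k where k: "k \<in> alg_hom K (quot_algebra P J) B" "bij_betw k (carrier (quot_algebra P J)) (carrier B)"
    using alg_first_isomorphism[OF algebra_bipoly B h J_def] by metis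
  have Q: "algebra K (quot_algebra P J)" by (rule algebra_quot_algebra[OF algebra_bipoly J])
  have "finite_dim K (quot_algebra P J)"
    using finite_dim_alg_hom_image[OF B Q alg_hom_inv_into[OF Q B k]
        bij_betw_imp_surj_on[OF bij_betw_inv_into[OF k(2)]] fin] .
  moreover have "\<beta> \<zero>\<^bsub>B\<^esub> = \<zero>"
  proof -
    have b0: "\<beta> \<zero>\<^bsub>B\<^esub> \<in> carrier K" using tr B.zero_closed by (auto simp: is_trace_def)
    have "\<beta> (\<zero> \<odot>\<^bsub>B\<^esub> \<zero>\<^bsub>B\<^esub>) = \<zero> \<otimes> \<beta> \<zero>\<^bsub>B\<^esub>"
      using tr B.zero_closed zero_closed unfolding is_trace_def by blast
    then show ?thesis using b0 B.zero_closed by simp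
  qed
  then have "J \<subseteq> functional_kernel K (series_of_datum D)"
    by (auto simp: J_def functional_kernel_def fh)
  ultimately have rec: "recognizable K (series_of_datum D)"
    unfolding recognizable_def using al J by blast
  have "\<exists>l g. series_of_datum D l g \<noteq> \<zero>"
  proof (rule ccontr)
    assume "\<not> ?thesis"
    then have zero: "series_of_datum D l g = \<zero>" for l g by blast
    have f0: "functional K (series_of_datum D) p = \<zero>" if "p \<in> carrier P" for p
      using that
    proof (induction rule: bipoly_induct)
      case (monom c l g)
      show ?case using functional_smult_bimonom[OF al monom, of l g] zero[of l g] monom by simp
    next
      case (add p q)
      then show ?case by (simp only: functional_add[OF al] r_zero zero_closed)
    qed
    have "\<beta> y = \<zero>" if "y \<in> carrier B" for y
      using that f0 fh unfolding h(2)[symmetric] by auto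
    then have "x = \<zero>\<^bsub>B\<^esub>" if "x \<in> carrier B" for x
      using nd[OF that] that by (simp add: B.m_closed)
    then show False using nz B.zero_closed by blast
  qed
  with rec show ?thesis by (simp add: nonzero_recognizable_def)
qed

text \<open>Here non-degeneracy of \<open>\<beta>\<close> is decisive: it forces the radical \<open>I\<^sub>\<alpha>\<close> of the form pulled back to
  \<open>P\<close> to be no larger than the kernel of the evaluation map.\<close>

lemma syntactic_ideal_eq_kernel:
  assumes nd: "nondegenerate_trace K B \<beta>" and B: "algebra K B"
    and h: "h \<in> alg_hom K P B" "h ` carrier P = carrier B"
    and fh: "\<And>p. p \<in> carrier P \<Longrightarrow> functional K \<alpha> p = \<beta> (h p)"
  shows "syntactic_ideal K \<alpha> = {p \<in> carrier P. h p = \<zero>\<^bsub>B\<^esub>}"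
proof -
  interpret B: algebra K B by fact
  interpret h: ring_hom_cring P B h using alg_hom_ring_hom_cring[OF algebra_bipoly B h(1)] .
  have "p \<in> syntactic_ideal K \<alpha> \<longleftrightarrow> h p = \<zero>\<^bsub>B\<^esub>" if p: "p \<in> carrier P" for p
  proof -
    have "p \<in> syntactic_ideal K \<alpha> \<longleftrightarrow> (\<forall>f \<in> carrier P. \<beta> (h p \<otimes>\<^bsub>B\<^esub> h f) = \<zero>)"
      using p by (auto simp: syntactic_ideal_def fh)
    also have "\<dots> \<longleftrightarrow> (\<forall>y \<in> carrier B. \<beta> (h p \<otimes>\<^bsub>B\<^esub> y) = \<zero>)"
      unfolding h(2)[symmetric] by simp
    also have "\<dots> \<longleftrightarrow> h p = \<zero>\<^bsub>B\<^esub>"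
    proof
      assume "\<forall>y \<in> carrier B. \<beta> (h p \<otimes>\<^bsub>B\<^esub> y) = \<zero>"
      then show "h p = \<zero>\<^bsub>B\<^esub>"
        using nd h.hom_closed[OF p] unfolding nondegenerate_trace_def by blast
    next
      assume hp: "h p = \<zero>\<^bsub>B\<^esub>"
      have b0: "\<beta> \<zero>\<^bsub>B\<^esub> \<in> carrier K" "\<beta> (\<zero> \<odot>\<^bsub>B\<^esub> \<zero>\<^bsub>B\<^esub>) = \<zero> \<otimes> \<beta> \<zero>\<^bsub>B\<^esub>"
        using nd B.zero_closed zero_closed unfolding nondegenerate_trace_def is_trace_def by blast+
      then have "\<beta> \<zero>\<^bsub>B\<^esub> = \<zero>" using B.zero_closed by simp
      then show "\<forall>y \<in> carrier B. \<beta> (h p \<otimes>\<^bsub>B\<^esub> y) = \<zero>" by (simp add: hp B.l_null)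
    qed
    finally show ?thesis .
  qed
  then show ?thesis by (auto simp: syntactic_ideal_def)
qed

lemma syntactic_datum_series_of_datum_iso:
  assumes "D \<in> frobenius_data K"
  shows "datum_iso K (syntactic_datum K (series_of_datum D)) D"
proof -
  obtain B g1 g2 \<beta> where D: "D = (B, g1, g2, \<beta>)" by (cases D)
  have B: "algebra K B" and nd: "nondegenerate_trace K B \<beta>"
    using assms D by (auto simp: frobenius_data_def comm_frobenius_algebra_def)
  let ?\<alpha> = "series_of_datum D"
  obtain h where h: "h \<in> alg_hom K P B" "h ` carrier P = carrier B" "h (T1 K) = g1" "h (T2 K) = g2"
    and al: "?\<alpha> \<in> biseries K" and fh: "\<And>p. p \<in> carrier P \<Longrightarrow> functional K ?\<alpha> p = \<beta> (h p)"
    using frobenius_data_evaluation[of B g1 g2 \<beta>] assms D by metis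
  obtain k where k: "k \<in> alg_hom K (syntactic_algebra K ?\<alpha>) B"
      "bij_betw k (carrier (syntactic_algebra K ?\<alpha>)) (carrier B)"
      "\<And>p. p \<in> carrier P \<Longrightarrow> k (poly_class K ?\<alpha> p) = h p"
    using alg_first_isomorphism[OF algebra_bipoly B h(1,2)
        syntactic_ideal_eq_kernel[OF nd B h(1,2) fh]]
    unfolding syntactic_algebra_def poly_class_def by metis
  have "\<beta> (k X) = induced_trace K ?\<alpha> X" if "X \<in> carrier (syntactic_algebra K ?\<alpha>)" for X
    using that by (auto simp: carrier_syntactic_algebra[OF al] k(3) induced_trace_poly_class[OF al] fh)
  then show ?thesis
    using k h(3,4) T1_closed T2_closed
    unfolding D syntactic_datum_def datum_iso.simps
    by (intro bexI[of _ k]) (simp_all add: alg_hom_def ring_iso_def)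
qed

end

section \<open>Isomorphisms of data and the classification\<close>

lemma datum_iso_iff_alg_hom:
  "datum_iso K (B, g1, g2, \<beta>) (B', g1', g2', \<beta>') \<longleftrightarrow>
     (\<exists>h \<in> alg_hom K B B'. bij_betw h (carrier B) (carrier B') \<and>
        h g1 = g1' \<and> h g2 = g2' \<and> (\<forall>x \<in> carrier B. \<beta>' (h x) = \<beta> x))"
  by (auto simp: alg_hom_def ring_iso_def)

lemma datum_iso_refl: "datum_iso K D D"
proof -
  obtain B g1 g2 \<beta> where D: "D = (B, g1, g2, \<beta>)" by (cases D)
  show ?thesis
    unfolding D datum_iso_iff_alg_hom
    by (intro bexI[of _ "\<lambda>x. x"]) (auto simp: alg_hom_def ring_hom_def bij_betw_def)
qed

lemma datum_iso_trans:
  assumes "datum_iso K D D'" "datum_iso K D' D''"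
  shows "datum_iso K D D''"
proof -
  obtain B g1 g2 \<beta> where D: "D = (B, g1, g2, \<beta>)" by (cases D)
  obtain B' g1' g2' \<beta>' where D': "D' = (B', g1', g2', \<beta>')" by (cases D')
  obtain B'' g1'' g2'' \<beta>'' where D'': "D'' = (B'', g1'', g2'', \<beta>'')" by (cases D'')
  obtain h where h: "h \<in> alg_hom K B B'" "bij_betw h (carrier B) (carrier B')"
      "h g1 = g1'" "h g2 = g2'" "\<forall>x \<in> carrier B. \<beta>' (h x) = \<beta> x"
    using assms(1) unfolding D D' datum_iso_iff_alg_hom by (elim bexE conjE)
  obtain k where k: "k \<in> alg_hom K B' B''" "bij_betw k (carrier B') (carrier B'')"
      "k g1' = g1''" "k g2' = g2''" "\<forall>x \<in> carrier B'. \<beta>'' (k x) = \<beta>' x"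
    using assms(2) unfolding D' D'' datum_iso_iff_alg_hom by (elim bexE conjE)
  have hcl: "h x \<in> carrier B'" if "x \<in> carrier B" for x
    using ring_hom_closed[OF alg_hom_ring_hom[OF h(1)] that] .
  have "k \<circ> h \<in> ring_hom B B''"
    using ring_hom_trans[OF alg_hom_ring_hom[OF h(1)] alg_hom_ring_hom[OF k(1)]] .
  then have "k \<circ> h \<in> alg_hom K B B''"
    using alg_hom_smult[OF h(1)] alg_hom_smult[OF k(1)] hcl by (simp add: alg_hom_def)
  then show ?thesis
    unfolding D D'' datum_iso_iff_alg_hom
    using bij_betw_trans[OF h(2) k(2)] h(3-5) k(3-5) hcl by (intro bexI[of _ "k \<circ> h"]) auto
qed

lemma datum_iso_sym:
  assumes D: "D \<in> frobenius_data K" and D': "D' \<in> frobenius_data K" and iso: "datum_iso K D D'"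
  shows "datum_iso K D' D"
proof -
  obtain B g1 g2 \<beta> where D1: "D = (B, g1, g2, \<beta>)" by (cases D)
  obtain B' g1' g2' \<beta>' where D2: "D' = (B', g1', g2', \<beta>')" by (cases D')
  have B: "algebra K B" "g1 \<in> carrier B" "g2 \<in> carrier B" and B': "algebra K B'"
    using D D' by (auto simp: D1 D2 frobenius_data_def comm_frobenius_algebra_def)
  obtain h where h: "h \<in> alg_hom K B B'" "bij_betw h (carrier B) (carrier B')"
      "h g1 = g1'" "h g2 = g2'" "\<forall>x \<in> carrier B. \<beta>' (h x) = \<beta> x"
    using iso unfolding D1 D2 datum_iso_iff_alg_hom by (elim bexE conjE)
  let ?k = "inv_into (carrier B) h"
  have hk: "h (?k y) = y" "?k y \<in> carrier B" if "y \<in> carrier B'" for y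
    using bij_betw_inv_into_right[OF h(2) that] bij_betwE[OF bij_betw_inv_into[OF h(2)]] that by auto
  show ?thesis
    unfolding D1 D2 datum_iso_iff_alg_hom
  proof (intro bexI conjI ballI)
    show "?k \<in> alg_hom K B' B" by (rule alg_hom_inv_into[OF B(1) B' h(1,2)])
    show "bij_betw ?k (carrier B') (carrier B)" by (rule bij_betw_inv_into[OF h(2)])
    show "?k g1' = g1" "?k g2' = g2"
      using bij_betw_inv_into_left[OF h(2)] B(2,3) h(3,4) by auto
    show "\<beta> (?k y) = \<beta>' y" if "y \<in> carrier B'" for y
      using h(5) hk[OF that] by metis
  qed
qed

lemma datum_iso_imp_series_of_datum_eq:
  assumes D: "D \<in> frobenius_data K" and D': "D' \<in> frobenius_data K" and iso: "datum_iso K D D'"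
  shows "series_of_datum D = series_of_datum D'"
proof -
  obtain B g1 g2 \<beta> where D1: "D = (B, g1, g2, \<beta>)" by (cases D)
  obtain B' g1' g2' \<beta>' where D2: "D' = (B', g1', g2', \<beta>')" by (cases D')
  have B: "algebra K B" "g1 \<in> carrier B" "g2 \<in> carrier B" and B': "algebra K B'"
    using D D' by (auto simp: D1 D2 frobenius_data_def comm_frobenius_algebra_def)
  obtain h where h: "h \<in> alg_hom K B B'"
      "h g1 = g1'" "h g2 = g2'" "\<forall>x \<in> carrier B. \<beta>' (h x) = \<beta> x"
    using iso unfolding D1 D2 datum_iso_iff_alg_hom by (elim bexE conjE)
  interpret h: ring_hom_cring B B' h using alg_hom_ring_hom_cring[OF B(1) B' h(1)] .
  have "\<beta>' (g1' [^]\<^bsub>B'\<^esub> l \<otimes>\<^bsub>B'\<^esub> g2' [^]\<^bsub>B'\<^esub> g) = \<beta> (g1 [^]\<^bsub>B\<^esub> l \<otimes>\<^bsub>B\<^esub> g2 [^]\<^bsub>B\<^esub> g)"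
    for l g :: nat
  proof -
    have "g1' [^]\<^bsub>B'\<^esub> l \<otimes>\<^bsub>B'\<^esub> g2' [^]\<^bsub>B'\<^esub> g = h (g1 [^]\<^bsub>B\<^esub> l \<otimes>\<^bsub>B\<^esub> g2 [^]\<^bsub>B\<^esub> g)"
      using B(2,3) by (simp add: h(2,3)[symmetric])
    moreover have "g1 [^]\<^bsub>B\<^esub> l \<otimes>\<^bsub>B\<^esub> g2 [^]\<^bsub>B\<^esub> g \<in> carrier B"
      using B(2,3) by simp
    ultimately show ?thesis using h(4) by simp
  qed
  then show ?thesis by (auto simp: D1 D2)
qed

text \<open>Two data with the same series are compared through the syntactic datum of that series.\<close>

lemma datum_iso_iff_series_of_datum_eq:
  assumes K: "cring K" and D: "D \<in> frobenius_data K" and D': "D' \<in> frobenius_data K"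
  shows "datum_iso K D D' \<longleftrightarrow> series_of_datum D = series_of_datum D'"
proof
  interpret bipoly K by (rule bipoly.intro[OF K])
  assume eq: "series_of_datum D = series_of_datum D'"
  let ?S = "syntactic_datum K (series_of_datum D)"
  have S: "?S \<in> frobenius_data K"
    by (rule syntactic_datum_frobenius[OF series_of_datum_nonzero_recognizable[OF D]])
  have "datum_iso K D ?S"
    by (rule datum_iso_sym[OF S D syntactic_datum_series_of_datum_iso[OF D]])
  moreover have "datum_iso K ?S D'"
    unfolding eq by (rule syntactic_datum_series_of_datum_iso[OF D'])
  ultimately show "datum_iso K D D'" by (rule datum_iso_trans)
qed (rule datum_iso_imp_series_of_datum_eq[OF D D'])

lemma equiv_data_isomorphism: "equiv (frobenius_data K) (data_isomorphism K)"
proof (rule equivI)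
  show "data_isomorphism K \<subseteq> frobenius_data K \<times> frobenius_data K"
    by (auto simp: data_isomorphism_def)
  show "refl_on (frobenius_data K) (data_isomorphism K)"
    by (auto simp: refl_on_def data_isomorphism_def datum_iso_refl simp del: datum_iso.simps)
  show "sym (data_isomorphism K)"
    by (auto simp: data_isomorphism_def simp del: datum_iso.simps intro: symI datum_iso_sym)
  show "trans (data_isomorphism K)"
    unfolding data_isomorphism_def
    by (rule transI) (auto simp del: datum_iso.simps intro: datum_iso_trans)
qed

theorem mainTheorem1:
  fixes K :: "('a, 'm) ring_scheme"
  assumes "field K"
  shows
    \<comment> \<open>the map from series to data\<close>
    "(\<forall>\<alpha> \<in> nonzero_recognizable K.
        syntactic_datum K \<alpha> \<in> frobenius_data K \<and>
        (\<forall>p \<in> carrier (bipoly_algebra K).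
           induced_trace K \<alpha> (poly_class K \<alpha> p) = functional K \<alpha> p)) \<and>
     \<comment> \<open>the map from data (with carrier in any type) to series\<close>
     (\<forall>D :: ('a, 'b) datum. D \<in> frobenius_data K \<longrightarrow>
        series_of_datum D \<in> nonzero_recognizable K) \<and>
     \<comment> \<open>equality of series amounts to isomorphism of data\<close>
     (\<forall>(D :: ('a, 'b) datum) (D' :: ('a, 'c) datum).
        D \<in> frobenius_data K \<and> D' \<in> frobenius_data K \<longrightarrow>
        (datum_iso K D D' \<longleftrightarrow> series_of_datum D = series_of_datum D')) \<and>
     \<comment> \<open>the two maps are mutually inverse up to isomorphism\<close>
     (\<forall>\<alpha> \<in> nonzero_recognizable K. series_of_datum (syntactic_datum K \<alpha>) = \<alpha>) \<and>
     (\<forall>D :: ('a, 'b) datum. D \<in> frobenius_data K \<longrightarrow>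
        datum_iso K (syntactic_datum K (series_of_datum D)) D) \<and>
     \<comment> \<open>the bijection with the set of isomorphism classes\<close>
     equiv (frobenius_data K)
       (data_isomorphism K :: (('a, 'a bipoly set) datum \<times> ('a, 'a bipoly set) datum) set) \<and>
     bij_betw (\<lambda>\<alpha>. data_isomorphism K `` {syntactic_datum K \<alpha>})
       (nonzero_recognizable K) (frobenius_data K // data_isomorphism K) \<and>
     (\<forall>D \<in> frobenius_data K.
        the_inv_into (nonzero_recognizable K) (\<lambda>\<alpha>. data_isomorphism K `` {syntactic_datum K \<alpha>})
          (data_isomorphism K `` {D}) = series_of_datum D)"
proof (intro conjI)
  have K: "cring K" using assms by (simp add: field_def domain_def)
  interpret bipoly K by (rule bipoly.intro[OF K])
  let ?R = "data_isomorphism K :: (('a, 'a bipoly set) datum \<times> ('a, 'a bipoly set) datum) set"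
  let ?F = "\<lambda>\<alpha>. ?R `` {syntactic_datum K \<alpha>}"
  have al: "\<alpha> \<in> biseries K" if "\<alpha> \<in> nonzero_recognizable K" for \<alpha>
    using that by (simp add: nonzero_recognizable_def recognizable_def)
  show "\<forall>\<alpha> \<in> nonzero_recognizable K.
        syntactic_datum K \<alpha> \<in> frobenius_data K \<and>
        (\<forall>p \<in> carrier (bipoly_algebra K).
           induced_trace K \<alpha> (poly_class K \<alpha> p) = functional K \<alpha> p)"
    using syntactic_datum_frobenius induced_trace_poly_class[OF al] by blast
  show "\<forall>D :: ('a, 'b) datum. D \<in> frobenius_data K \<longrightarrow> series_of_datum D \<in> nonzero_recognizable K"
    using series_of_datum_nonzero_recognizable by blast
  show "\<forall>(D :: ('a, 'b) datum) (D' :: ('a, 'c) datum).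
        D \<in> frobenius_data K \<and> D' \<in> frobenius_data K \<longrightarrow>
        (datum_iso K D D' \<longleftrightarrow> series_of_datum D = series_of_datum D')"
    using datum_iso_iff_series_of_datum_eq[OF K] by blast
  show series_syn: "\<forall>\<alpha> \<in> nonzero_recognizable K. series_of_datum (syntactic_datum K \<alpha>) = \<alpha>"
    using series_of_syntactic_datum[OF al] by blast
  show "\<forall>D :: ('a, 'b) datum. D \<in> frobenius_data K \<longrightarrow>
        datum_iso K (syntactic_datum K (series_of_datum D)) D"
    using syntactic_datum_series_of_datum_iso by blast
  show eq: "equiv (frobenius_data K) ?R" by (rule equiv_data_isomorphism)
  have F_series: "?F (series_of_datum D) = ?R `` {D}"
    if D: "D \<in> frobenius_data K" for D :: "('a, 'a bipoly set) datum"
  proof (rule equiv_class_eq[OF eq])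
    show "(syntactic_datum K (series_of_datum D), D) \<in> ?R"
      using D syntactic_datum_frobenius[OF series_of_datum_nonzero_recognizable[OF D]]
        syntactic_datum_series_of_datum_iso[OF D]
      by (simp add: data_isomorphism_def)
  qed
  have inj: "inj_on ?F (nonzero_recognizable K)"
  proof (rule inj_onI)
    fix \<alpha> \<alpha>' assume a: "\<alpha> \<in> nonzero_recognizable K" "\<alpha>' \<in> nonzero_recognizable K" "?F \<alpha> = ?F \<alpha>'"
    have S: "syntactic_datum K \<alpha> \<in> frobenius_data K" "syntactic_datum K \<alpha>' \<in> frobenius_data K"
      using a(1,2) by (auto intro: syntactic_datum_frobenius)
    have "(syntactic_datum K \<alpha>, syntactic_datum K \<alpha>') \<in> ?R"
      using eq_equiv_class[OF a(3) eq S(2)] .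
    then have "datum_iso K (syntactic_datum K \<alpha>) (syntactic_datum K \<alpha>')"
      by (simp add: data_isomorphism_def)
    then have "series_of_datum (syntactic_datum K \<alpha>) = series_of_datum (syntactic_datum K \<alpha>')"
      by (rule datum_iso_imp_series_of_datum_eq[OF S])
    then show "\<alpha> = \<alpha>'" using series_syn a(1,2) by simp
  qed
  have "?F ` nonzero_recognizable K = frobenius_data K // ?R"
  proof (intro equalityI subsetI)
    fix X assume "X \<in> ?F ` nonzero_recognizable K"
    then show "X \<in> frobenius_data K // ?R"
      by (auto intro: quotientI syntactic_datum_frobenius)
  next
    fix X assume "X \<in> frobenius_data K // ?R"
    then obtain D where D: "D \<in> frobenius_data K" "X = ?R `` {D}" by (elim quotientE)
    show "X \<in> ?F ` nonzero_recognizable K"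
      unfolding D(2) F_series[OF D(1), symmetric]
      by (intro imageI series_of_datum_nonzero_recognizable[OF D(1)])
  qed
  with inj show "bij_betw ?F (nonzero_recognizable K) (frobenius_data K // ?R)"
    by (simp add: bij_betw_def)
  show "\<forall>D \<in> frobenius_data K.
        the_inv_into (nonzero_recognizable K) ?F (?R `` {D}) = series_of_datum D"
    using the_inv_into_f_eq[OF inj F_series series_of_datum_nonzero_recognizable] by blast
qed

end
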